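(* Judgmental equality in Martin-Löf type theory with extensional identity types, $\Pi$-types and a universe $\mathrm U$ (not assumed to be closed under any type formers) is undecidable: there is no algorithm which, given a context $\Gamma$, a type $A$ and terms $M,M'$ such that $\Gamma\vdash M:A$ and $\Gamma\vdash M':A$ are derivable, decides whether $\Gamma\vdash M=M':A$ is derivable.
   Context: Judgments: $\Gamma\vdash$ (well-formed context), $\Gamma\vdash A$, $\Gamma\vdash A=A'$, $\Gamma\vdash a:A$, $\Gamma\vdash a=a':A$, with the usual structural rules of dependent type theory (context formation, variables, weakening, substitution, equality is an equivalence relation and a congruence for all operations, conversion of terms along type equality). Universe: $\Gamma\vdash\mathrm U$ in every well-formed context; if $\Gamma\vdash X:\mathrm U$ then $\Gamma\vdash X$ (an element of the universe is a type), and if $\Gamma\vdash X=X':\mathrm U$ then $\Gamma\vdash X=X'$. No closure properties of $\mathrm U$ are required. There is no base type. $\Pi$-types: the usual formation, $\lambda$-abstraction and application rules, with $\beta$ and $\eta$ as judgmental equalities. Extensional identity types: formation $\Gamma\vdash \mathrm{I}(A,a,a')$ when $\Gamma\vdash a:A$ and $\Gamma\vdash a':A$; introduction $\Gamma\vdash \mathrm{r}(a):\mathrm{I}(A,a,a)$; and from $\Gamma\vdash c:\mathrm{I}(A,a,a')$ infer $\Gamma\vdash a=a':A$ and $\Gamma\vdash c=\mathrm{r}(a):\mathrm{I}(A,a,a')$. *)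

theory Defs
  imports Main "HOL-Library.Nat_Bijection"
begin

section \<open>Extensional Martin-Loef type theory\<close>

text \<open>
  Raw syntax with de Bruijn indices. The universe is a la Russell, so types and terms share
  one syntactic category. \<open>Pi A B\<close> binds index 0 in \<open>B\<close>, and \<open>Lam A b\<close> binds index 0 in \<open>b\<close>.
\<close>

datatype expr =
    Var nat
  | Univ
  | Pi expr expr
  | Lam expr expr
  | App expr expr
  | Id expr expr expr
  | Refl expr

text \<open>\<open>lift d k t\<close> adds \<open>d\<close> to every index of \<open>t\<close> that is at least \<open>k\<close>.\<close>

primrec lift :: "nat \<Rightarrow> nat \<Rightarrow> expr \<Rightarrow> expr" where
  "lift d k (Var i) = Var (if i < k then i else i + d)"
| "lift d k Univ = Univ"
| "lift d k (Pi A B) = Pi (lift d k A) (lift d (Suc k) B)"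
| "lift d k (Lam A b) = Lam (lift d k A) (lift d (Suc k) b)"
| "lift d k (App c a) = App (lift d k c) (lift d k a)"
| "lift d k (Id A a b) = Id (lift d k A) (lift d k a) (lift d k b)"
| "lift d k (Refl a) = Refl (lift d k a)"

text \<open>
  \<open>subst s k t\<close> replaces index \<open>k\<close> in \<open>t\<close> and lowers the larger indices. The expression \<open>s\<close> lives in
  the context below index \<open>k\<close>; it is therefore not lifted when passing a binder, but all at once
  at the leaves.
\<close>

primrec subst :: "expr \<Rightarrow> nat \<Rightarrow> expr \<Rightarrow> expr" where
  "subst s k (Var i) = (if i < k then Var i else if i = k then lift k 0 s else Var (i - 1))"
| "subst s k Univ = Univ"
| "subst s k (Pi A B) = Pi (subst s k A) (subst s (Suc k) B)"
| "subst s k (Lam A b) = Lam (subst s k A) (subst s (Suc k) b)"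
| "subst s k (App c a) = App (subst s k c) (subst s k a)"
| "subst s k (Id A a b) = Id (subst s k A) (subst s k a) (subst s k b)"
| "subst s k (Refl a) = Refl (subst s k a)"

abbreviation weaken :: "expr \<Rightarrow> expr" where
  "weaken t \<equiv> lift 1 0 t"

abbreviation inst :: "expr \<Rightarrow> expr \<Rightarrow> expr" where
  "inst t s \<equiv> subst s 0 t"

text \<open>
  Contexts list the most recent entry first: the entry of index \<open>i\<close> is an expression over
  the entries of index greater than \<open>i\<close>. Hence in \<open>\<Delta> @ \<Gamma>\<close> the list \<open>\<Delta>\<close> is a telescope over \<open>\<Gamma>\<close>, and
  the next two functions act on such a telescope when an entry right below it is inserted or
  instantiated.
\<close>

type_synonym ctx = "expr list"

primrec lift_tele :: "ctx \<Rightarrow> ctx" where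
  "lift_tele [] = []"
| "lift_tele (B # \<Delta>) = lift 1 (length \<Delta>) B # lift_tele \<Delta>"

primrec subst_tele :: "expr \<Rightarrow> ctx \<Rightarrow> ctx" where
  "subst_tele s [] = []"
| "subst_tele s (B # \<Delta>) = subst s (length \<Delta>) B # subst_tele s \<Delta>"

datatype judgement =
    IsCtx
  | IsType expr
  | EqType expr expr
  | HasType expr expr       \<comment> \<open>\<open>HasType a A\<close> is \<open>a : A\<close>\<close>
  | EqTerm expr expr expr   \<comment> \<open>\<open>EqTerm a a' A\<close> is \<open>a = a' : A\<close>\<close>

primrec map_judgement :: "(expr \<Rightarrow> expr) \<Rightarrow> judgement \<Rightarrow> judgement" where
  "map_judgement f IsCtx = IsCtx"
| "map_judgement f (IsType A) = IsType (f A)"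
| "map_judgement f (EqType A A') = EqType (f A) (f A')"
| "map_judgement f (HasType a A) = HasType (f a) (f A)"
| "map_judgement f (EqTerm a a' A) = EqTerm (f a) (f a') (f A)"

inductive deriv :: "ctx \<Rightarrow> judgement \<Rightarrow> bool" (infix "\<turnstile>" 50) where
  \<comment> \<open>contexts, variables, weakening and substitution; variables other than the most recent one
     are obtained by weakening\<close>
  ctx_empty: "[] \<turnstile> IsCtx"
| ctx_ext: "\<lbrakk>\<Gamma> \<turnstile> IsCtx; \<Gamma> \<turnstile> IsType A\<rbrakk> \<Longrightarrow> A # \<Gamma> \<turnstile> IsCtx"
| var: "\<lbrakk>\<Gamma> \<turnstile> IsCtx; \<Gamma> \<turnstile> IsType A\<rbrakk> \<Longrightarrow> A # \<Gamma> \<turnstile> HasType (Var 0) (weaken A)"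
| weakening: "\<lbrakk>\<Delta> @ \<Gamma> \<turnstile> J; \<Gamma> \<turnstile> IsType A\<rbrakk>
    \<Longrightarrow> lift_tele \<Delta> @ A # \<Gamma> \<turnstile> map_judgement (lift 1 (length \<Delta>)) J"
| substitution: "\<lbrakk>\<Delta> @ A # \<Gamma> \<turnstile> J; \<Gamma> \<turnstile> HasType a A\<rbrakk>
    \<Longrightarrow> subst_tele a \<Delta> @ \<Gamma> \<turnstile> map_judgement (subst a (length \<Delta>)) J"
| subst_cong_type: "\<lbrakk>A # \<Gamma> \<turnstile> IsType B; \<Gamma> \<turnstile> EqTerm a a' A\<rbrakk>
    \<Longrightarrow> \<Gamma> \<turnstile> EqType (inst B a) (inst B a')"
| subst_cong_term: "\<lbrakk>A # \<Gamma> \<turnstile> HasType b B; \<Gamma> \<turnstile> EqTerm a a' A\<rbrakk>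
    \<Longrightarrow> \<Gamma> \<turnstile> EqTerm (inst b a) (inst b a') (inst B a)"
  \<comment> \<open>equality is an equivalence relation; conversion\<close>
| type_refl: "\<Gamma> \<turnstile> IsType A \<Longrightarrow> \<Gamma> \<turnstile> EqType A A"
| type_sym: "\<Gamma> \<turnstile> EqType A B \<Longrightarrow> \<Gamma> \<turnstile> EqType B A"
| type_trans: "\<lbrakk>\<Gamma> \<turnstile> EqType A B; \<Gamma> \<turnstile> EqType B C\<rbrakk> \<Longrightarrow> \<Gamma> \<turnstile> EqType A C"
| term_refl: "\<Gamma> \<turnstile> HasType a A \<Longrightarrow> \<Gamma> \<turnstile> EqTerm a a A"
| term_sym: "\<Gamma> \<turnstile> EqTerm a b A \<Longrightarrow> \<Gamma> \<turnstile> EqTerm b a A"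
| term_trans: "\<lbrakk>\<Gamma> \<turnstile> EqTerm a b A; \<Gamma> \<turnstile> EqTerm b c A\<rbrakk> \<Longrightarrow> \<Gamma> \<turnstile> EqTerm a c A"
| conv: "\<lbrakk>\<Gamma> \<turnstile> HasType a A; \<Gamma> \<turnstile> EqType A B\<rbrakk> \<Longrightarrow> \<Gamma> \<turnstile> HasType a B"
| conv_eq: "\<lbrakk>\<Gamma> \<turnstile> EqTerm a a' A; \<Gamma> \<turnstile> EqType A B\<rbrakk> \<Longrightarrow> \<Gamma> \<turnstile> EqTerm a a' B"
  \<comment> \<open>universe\<close>
| univ_form: "\<Gamma> \<turnstile> IsCtx \<Longrightarrow> \<Gamma> \<turnstile> IsType Univ"
| univ_el: "\<Gamma> \<turnstile> HasType X Univ \<Longrightarrow> \<Gamma> \<turnstile> IsType X"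
| univ_el_cong: "\<Gamma> \<turnstile> EqTerm X X' Univ \<Longrightarrow> \<Gamma> \<turnstile> EqType X X'"
  \<comment> \<open>dependent products\<close>
| pi_form: "\<lbrakk>\<Gamma> \<turnstile> IsType A; A # \<Gamma> \<turnstile> IsType B\<rbrakk> \<Longrightarrow> \<Gamma> \<turnstile> IsType (Pi A B)"
| pi_form_cong: "\<lbrakk>\<Gamma> \<turnstile> EqType A A'; A # \<Gamma> \<turnstile> EqType B B'\<rbrakk>
    \<Longrightarrow> \<Gamma> \<turnstile> EqType (Pi A B) (Pi A' B')"
| pi_intro: "\<lbrakk>\<Gamma> \<turnstile> IsType A; A # \<Gamma> \<turnstile> HasType b B\<rbrakk> \<Longrightarrow> \<Gamma> \<turnstile> HasType (Lam A b) (Pi A B)"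
| pi_intro_cong: "\<lbrakk>\<Gamma> \<turnstile> EqType A A'; A # \<Gamma> \<turnstile> EqTerm b b' B\<rbrakk>
    \<Longrightarrow> \<Gamma> \<turnstile> EqTerm (Lam A b) (Lam A' b') (Pi A B)"
| pi_elim: "\<lbrakk>\<Gamma> \<turnstile> HasType c (Pi A B); \<Gamma> \<turnstile> HasType a A\<rbrakk>
    \<Longrightarrow> \<Gamma> \<turnstile> HasType (App c a) (inst B a)"
| pi_elim_cong: "\<lbrakk>\<Gamma> \<turnstile> EqTerm c c' (Pi A B); \<Gamma> \<turnstile> EqTerm a a' A\<rbrakk>
    \<Longrightarrow> \<Gamma> \<turnstile> EqTerm (App c a) (App c' a') (inst B a)"
| pi_beta: "\<lbrakk>\<Gamma> \<turnstile> IsType A; A # \<Gamma> \<turnstile> HasType b B; \<Gamma> \<turnstile> HasType a A\<rbrakk>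
    \<Longrightarrow> \<Gamma> \<turnstile> EqTerm (App (Lam A b) a) (inst b a) (inst B a)"
| pi_eta: "\<Gamma> \<turnstile> HasType c (Pi A B)
    \<Longrightarrow> \<Gamma> \<turnstile> EqTerm (Lam A (App (weaken c) (Var 0))) c (Pi A B)"
  \<comment> \<open>extensional identity types\<close>
| id_form: "\<lbrakk>\<Gamma> \<turnstile> IsType A; \<Gamma> \<turnstile> HasType a A; \<Gamma> \<turnstile> HasType a' A\<rbrakk> \<Longrightarrow> \<Gamma> \<turnstile> IsType (Id A a a')"
| id_form_cong: "\<lbrakk>\<Gamma> \<turnstile> EqType A B; \<Gamma> \<turnstile> EqTerm a b A; \<Gamma> \<turnstile> EqTerm a' b' A\<rbrakk>
    \<Longrightarrow> \<Gamma> \<turnstile> EqType (Id A a a') (Id B b b')"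
| id_intro: "\<Gamma> \<turnstile> HasType a A \<Longrightarrow> \<Gamma> \<turnstile> HasType (Refl a) (Id A a a)"
| id_intro_cong: "\<Gamma> \<turnstile> EqTerm a a' A \<Longrightarrow> \<Gamma> \<turnstile> EqTerm (Refl a) (Refl a') (Id A a a)"
| id_reflection: "\<Gamma> \<turnstile> HasType c (Id A a a') \<Longrightarrow> \<Gamma> \<turnstile> EqTerm a a' A"
| id_unique: "\<Gamma> \<turnstile> HasType c (Id A a a') \<Longrightarrow> \<Gamma> \<turnstile> EqTerm c (Refl a) (Id A a a')"

section \<open>Algorithms\<close>

text \<open>
  Algorithms are partial recursive functions, given by their schemes. \<open>computes f xs y\<close> means that
  the function described by \<open>f\<close> is defined on \<open>xs\<close>, with value \<open>y\<close>. The recursion variable of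
  \<open>PrimRec\<close> and the search variable of \<open>Minimize\<close> are the first argument. Arities are not recorded:
  \<open>computes f\<close> restricted to argument lists of a fixed length \<open>n\<close> is an \<open>n\<close>-ary partial recursive
  function, and each of these arises in this way.
\<close>

datatype recfun =
    Zero
  | Succ
  | Proj nat
  | Compose recfun "recfun list"
  | PrimRec recfun recfun
  | Minimize recfun

inductive computes :: "recfun \<Rightarrow> nat list \<Rightarrow> nat \<Rightarrow> bool" where
  Zero: "computes Zero xs 0"
| Succ: "computes Succ [x] (Suc x)"
| Proj: "i < length xs \<Longrightarrow> computes (Proj i) xs (xs ! i)"
| Compose: "\<lbrakk>list_all2 (\<lambda>g y. computes g xs y) gs ys; computes f ys z\<rbrakk>
    \<Longrightarrow> computes (Compose f gs) xs z"
| PrimRec_0: "computes f xs y \<Longrightarrow> computes (PrimRec f g) (0 # xs) y"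
| PrimRec_Suc: "\<lbrakk>computes (PrimRec f g) (n # xs) y; computes g (n # y # xs) z\<rbrakk>
    \<Longrightarrow> computes (PrimRec f g) (Suc n # xs) z"
| Minimize: "\<lbrakk>computes f (n # xs) 0; \<forall>m<n. \<exists>y. computes f (m # xs) (Suc y)\<rbrakk>
    \<Longrightarrow> computes (Minimize f) xs n"

text \<open>
  Algorithms receive expressions and contexts through an explicit Goedel numbering: a constructor
  tag paired with the numbers of the arguments, using the Cantor pairing function.
\<close>

primrec expr_code :: "expr \<Rightarrow> nat" where
  "expr_code (Var i) = prod_encode (0, i)"
| "expr_code Univ = prod_encode (1, 0)"
| "expr_code (Pi A B) = prod_encode (2, prod_encode (expr_code A, expr_code B))"
| "expr_code (Lam A b) = prod_encode (3, prod_encode (expr_code A, expr_code b))"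
| "expr_code (App c a) = prod_encode (4, prod_encode (expr_code c, expr_code a))"
| "expr_code (Id A a b) =
     prod_encode (5, prod_encode (expr_code A, prod_encode (expr_code a, expr_code b)))"
| "expr_code (Refl a) = prod_encode (6, expr_code a)"

definition ctx_code :: "ctx \<Rightarrow> nat" where
  "ctx_code \<Gamma> = list_encode (map expr_code \<Gamma>)"

end

theory Submission
  imports Defs
begin

text \<open>
  A context can declare a first-order signature over \<open>Univ\<close> together with Horn clauses over it,
  because elements of \<open>Univ\<close> are types: an atom \<open>C f xs y : Univ\<close> is a proposition, and a clause is
  an iterated \<open>Pi\<close>. We use a fixed context whose clauses axiomatize the evaluation of partial
  recursive functions, with one further axiom saying that \<open>C f xs y\<close> implies
  \<open>Id Univ (C f xs y) leaf\<close>. By reflection, \<open>C f xs y = leaf\<close> is derivable whenever \<open>f\<close> has value \<open>y\<close>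
  on \<open>xs\<close>.

  Conversely, interpret types as partial equivalence relations on Engeler's graph model of the lambda
  calculus. They are closed under \<open>Pi\<close> and \<open>Id\<close>, and since \<open>Univ\<close> is not assumed closed under
  anything, it may be interpreted by the equality relation on the singletons of atoms, with any choice
  of atoms as the inhabited ones. Taking the atoms to be the first-order terms and \<open>C\<close> to be true
  evaluation validates all clauses, so a derivable \<open>C f xs y = leaf\<close> is true. A decision
  procedure for equality then contradicts itself by diagonalization.
\<close>

subsection \<open>A graph model of the lambda calculus\<close>

datatype 'v elem = Atom 'v | Arr "'v elem list" "'v elem"

text \<open>Engeler's application: \<open>Arr l b\<close> records that the finite argument
  \<open>set l\<close> suffices for the output \<open>b\<close>.\<close>

definition app :: "'v elem set \<Rightarrow> 'v elem set \<Rightarrow> 'v elem set" where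
  "app u v = {b. \<exists>l. set l \<subseteq> v \<and> Arr l b \<in> u}"

definition lam :: "('v elem set \<Rightarrow> 'v elem set) \<Rightarrow> 'v elem set" where
  "lam F = {Arr l b | l b. b \<in> F (set l)}"

type_synonym 'v env = "nat \<Rightarrow> 'v elem set"

text \<open>Only untyped computational content is kept: the annotation of \<open>Lam\<close> is
  dropped and proofs of identities carry no information. The formers \<open>Univ\<close>,
  \<open>Pi\<close> and \<open>Id\<close> get the dummy value \<open>{}\<close>, as they never occur
  as elements of a type.\<close>

primrec tmI :: "expr \<Rightarrow> 'v env \<Rightarrow> 'v elem set" where
  "tmI (Var i) \<rho> = \<rho> i"
| "tmI Univ \<rho> = {}"
| "tmI (Pi A B) \<rho> = {}"
| "tmI (Lam A b) \<rho> = lam (\<lambda>d. tmI b (case_nat d \<rho>))"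
| "tmI (App c a) \<rho> = app (tmI c \<rho>) (tmI a \<rho>)"
| "tmI (Id A a b) \<rho> = {}"
| "tmI (Refl a) \<rho> = {}"

lemma app_empty [simp]: "app {} a = {}"
  by (simp add: app_def)

lemma app_mono: "u \<subseteq> u' \<Longrightarrow> v \<subseteq> v' \<Longrightarrow> app u v \<subseteq> app u' v'"
  unfolding app_def by blast

lemma tmI_mono: "(\<And>i. \<rho> i \<subseteq> \<rho>' i) \<Longrightarrow> tmI e \<rho> \<subseteq> tmI e \<rho>'"
proof (induction e arbitrary: \<rho> \<rho>')
  case (Lam A b)
  have "tmI b (case_nat d \<rho>) \<subseteq> tmI b (case_nat d \<rho>')" for d
    by (rule Lam.IH) (simp add: Lam.prems split: nat.split)
  then show ?case by (auto simp: lam_def)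
qed (simp_all add: app_mono)

text \<open>Continuity: producing \<open>b\<close> consumes only finitely many elements of each
  variable. It lets the finite lists in \<open>Arr\<close> describe behaviour on infinite
  arguments.\<close>

lemma tmI_finitary:
  assumes "b \<in> tmI e \<rho>"
  shows "\<exists>\<rho>'. (\<forall>i. finite (\<rho>' i) \<and> \<rho>' i \<subseteq> \<rho> i) \<and> b \<in> tmI e \<rho>'"
  using assms
proof (induction e arbitrary: b \<rho>)
  case (Var j)
  then show ?case
    by (intro exI[of _ "\<lambda>i. if i = j then {b} else {}"]) auto
next
  case (Lam A t)
  then obtain l c where b: "b = Arr l c" and c: "c \<in> tmI t (case_nat (set l) \<rho>)"
    by (auto simp: lam_def)
  from Lam.IH(2)[OF c] obtain \<rho>' where
    \<rho>': "\<forall>i. finite (\<rho>' i) \<and> \<rho>' i \<subseteq> case_nat (set l) \<rho> i" "c \<in> tmI t \<rho>'" by blast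
  have "\<rho>' i \<subseteq> case_nat (set l) (\<lambda>i. \<rho>' (Suc i)) i" for i
    using \<rho>'(1)[rule_format, of 0] by (cases i) simp_all
  then have "tmI t \<rho>' \<subseteq> tmI t (case_nat (set l) (\<lambda>i. \<rho>' (Suc i)))"
    by (rule tmI_mono)
  moreover have "finite (\<rho>' (Suc i)) \<and> \<rho>' (Suc i) \<subseteq> \<rho> i" for i
    using \<rho>'(1)[rule_format, of "Suc i"] by simp
  ultimately show ?case
    using \<rho>'(2) b by (intro exI[of _ "\<lambda>i. \<rho>' (Suc i)"]) (auto simp: lam_def)
next
  case (App c a)
  then obtain l where l: "set l \<subseteq> tmI a \<rho>" and "Arr l b \<in> tmI c \<rho>"
    by (auto simp: app_def)
  from App.IH(1)[OF this(2)] obtain \<rho>1 where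
    \<rho>1: "\<forall>i. finite (\<rho>1 i) \<and> \<rho>1 i \<subseteq> \<rho> i" "Arr l b \<in> tmI c \<rho>1" by blast
  \<comment> \<open>Every element of \<open>l\<close> has its own finite environment; since
    \<open>l\<close> is finite, the union of these environments is finite again.\<close>
  from l have "\<exists>\<rho>2. (\<forall>i. finite (\<rho>2 i) \<and> \<rho>2 i \<subseteq> \<rho> i) \<and> set l \<subseteq> tmI a \<rho>2"
  proof (induction l)
    case Nil
    then show ?case by (intro exI[of _ "\<lambda>_. {}"]) simp
  next
    case (Cons x l)
    then obtain \<rho>2 where \<rho>2: "\<forall>i. finite (\<rho>2 i) \<and> \<rho>2 i \<subseteq> \<rho> i" "set l \<subseteq> tmI a \<rho>2"
      by auto
    from Cons.prems App.IH(2)[of x \<rho>] obtain \<rho>3 where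
      \<rho>3: "\<forall>i. finite (\<rho>3 i) \<and> \<rho>3 i \<subseteq> \<rho> i" "x \<in> tmI a \<rho>3" by auto
    have "tmI a \<rho>2 \<subseteq> tmI a (\<lambda>i. \<rho>2 i \<union> \<rho>3 i)" "tmI a \<rho>3 \<subseteq> tmI a (\<lambda>i. \<rho>2 i \<union> \<rho>3 i)"
      by (intro tmI_mono; simp)+
    with \<rho>2 \<rho>3 show ?case by (intro exI[of _ "\<lambda>i. \<rho>2 i \<union> \<rho>3 i"]) auto
  qed
  then obtain \<rho>2 where \<rho>2: "\<forall>i. finite (\<rho>2 i) \<and> \<rho>2 i \<subseteq> \<rho> i" "set l \<subseteq> tmI a \<rho>2"
    by blast
  have "tmI a \<rho>2 \<subseteq> tmI a (\<lambda>i. \<rho>1 i \<union> \<rho>2 i)" "tmI c \<rho>1 \<subseteq> tmI c (\<lambda>i. \<rho>1 i \<union> \<rho>2 i)"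
    by (intro tmI_mono; simp)+
  then have "b \<in> app (tmI c (\<lambda>i. \<rho>1 i \<union> \<rho>2 i)) (tmI a (\<lambda>i. \<rho>1 i \<union> \<rho>2 i))"
    using \<rho>1(2) \<rho>2(2) unfolding app_def by blast
  with \<rho>1(1) \<rho>2(1) show ?case
    by (intro exI[of _ "\<lambda>i. \<rho>1 i \<union> \<rho>2 i"]) simp
qed auto

text \<open>Semantic beta: one inclusion is monotonicity, the other is continuity, with
  \<open>l\<close> enumerating the finite part of \<open>d\<close> that is consumed.\<close>

lemma app_lam_tmI:
  "app (lam (\<lambda>d. tmI e (case_nat d \<rho>))) d = tmI e (case_nat d \<rho>)" (is "?L = ?R")
proof
  show "?L \<subseteq> ?R"
  proof
    fix b assume "b \<in> ?L"
    then obtain l where "set l \<subseteq> d" "b \<in> tmI e (case_nat (set l) \<rho>)"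
      by (auto simp: app_def lam_def)
    moreover from this(1) have "tmI e (case_nat (set l) \<rho>) \<subseteq> tmI e (case_nat d \<rho>)"
      by (intro tmI_mono) (simp split: nat.split)
    ultimately show "b \<in> ?R" by blast
  qed
  show "?R \<subseteq> ?L"
  proof
    fix b assume "b \<in> ?R"
    from tmI_finitary[OF this] obtain \<rho>' where
      \<rho>': "\<And>i. finite (\<rho>' i)" "\<And>i. \<rho>' i \<subseteq> case_nat d \<rho> i" "b \<in> tmI e \<rho>'" by blast
    obtain l where l: "set l = \<rho>' 0" using finite_list[OF \<rho>'(1)] by blast
    have "\<rho>' i \<subseteq> case_nat (set l) \<rho> i" for i
      using \<rho>'(2)[of i] by (cases i) (simp_all add: l)
    with \<rho>'(3) have "b \<in> tmI e (case_nat (set l) \<rho>)"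
      using tmI_mono by blast
    moreover have "set l \<subseteq> d" using \<rho>'(2)[of 0] l by simp
    ultimately show "b \<in> ?L" by (auto simp: app_def lam_def)
  qed
qed

lemma tmI_lift: "tmI (lift d k e) \<rho> = tmI e (\<lambda>i. \<rho> (if i < k then i else i + d))"
proof (induction e arbitrary: k \<rho>)
  case (Lam A b)
  have "case_nat x \<rho> (if i < Suc k then i else i + d) =
        case_nat x (\<lambda>i. \<rho> (if i < k then i else i + d)) i" for x i
    by (cases i) auto
  then show ?case by (simp add: Lam)
qed simp_all

text \<open>Since \<open>s\<close> lives below index \<open>k\<close>, it is evaluated in the
  environment without its first \<open>k\<close> entries.\<close>

definition env_inst :: "expr \<Rightarrow> nat \<Rightarrow> 'v env \<Rightarrow> 'v env" where
  "env_inst s k \<rho> i = (if i < k then \<rho> i else if i = k then tmI s (\<lambda>j. \<rho> (j + k)) else \<rho> (i - 1))"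

lemma env_inst_0: "env_inst s 0 \<rho> = case_nat (tmI s \<rho>) \<rho>"
  by (rule ext) (simp add: env_inst_def split: nat.split)

lemma env_inst_Suc: "env_inst s (Suc k) (case_nat x \<rho>) = case_nat x (env_inst s k \<rho>)"
proof
  fix i show "env_inst s (Suc k) (case_nat x \<rho>) i = case_nat x (env_inst s k \<rho>) i"
    by (cases i) (auto simp: env_inst_def split: nat.split)
qed

lemma tmI_subst: "tmI (subst s k e) \<rho> = tmI e (env_inst s k \<rho>)"
  by (induction e arbitrary: k \<rho>) (simp_all add: env_inst_Suc, simp add: env_inst_def tmI_lift)

subsection \<open>Types as partial equivalence relations\<close>

text \<open>Codes of semantic types. Type equality will be equality of codes, so products can be
  inverted; identity types store the classes of their endpoints rather than representatives.\<close>

datatype 'v sty =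
    SUniv
  | SEl "'v elem set"
  | SPi "'v sty" "'v elem set \<Rightarrow> 'v sty"
  | SId "'v sty" "'v elem set set" "'v elem set set"

locale universe_model =
  fixes T :: "'v set"
begin

text \<open>Elements of the universe are proof-irrelevant as types: everything is related if
  \<open>w\<close> is the singleton of an atom in \<open>T\<close>, nothing otherwise. Identity
  types behave likewise.\<close>

primrec per :: "'v sty \<Rightarrow> 'v elem set \<Rightarrow> 'v elem set \<Rightarrow> bool" where
  "per SUniv u v = (\<exists>x. u = {Atom x} \<and> v = {Atom x})"
| "per (SEl w) u v = (\<exists>x\<in>T. w = {Atom x})"
| "per (SPi A B) u v = (\<forall>a b. per A a b \<longrightarrow> per (B a) (app u a) (app v b))"
| "per (SId A c c') u v = (c = c')"

text \<open>For a class that arises from an endpoint, being nonempty says that the endpoint is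
  related to itself.\<close>

primrec wfty :: "'v sty \<Rightarrow> bool" where
  "wfty SUniv = True"
| "wfty (SEl w) = True"
| "wfty (SPi A B) = (wfty A \<and> (\<forall>a b. per A a b \<longrightarrow> B a = B b \<and> wfty (B a)))"
| "wfty (SId A c c') = (wfty A \<and> c \<noteq> {} \<and> c' \<noteq> {})"

text \<open>Both properties go into one induction: at a product, transitivity passes through
  \<open>per A a a\<close>, which takes symmetry and transitivity of the domain.\<close>

lemma per_sym_trans:
  "wfty A \<Longrightarrow> (per A u v \<longrightarrow> per A v u) \<and> (per A u v \<longrightarrow> per A v w \<longrightarrow> per A u w)"
proof (induction A arbitrary: u v w)
  case (SPi A B)
  note A = SPi.IH(1) and B = SPi.IH(2)[OF rangeI]
  have w: "wfty A" using SPi.prems by simp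
  have *: "per A b a \<and> per A a a \<and> B a = B b \<and> wfty (B a)" if ab: "per A a b" for a b
  proof (intro conjI)
    show ba: "per A b a" using A[OF w] ab by blast
    show "per A a a" using A[OF w, of a b a] ab ba by blast
    show "B a = B b" "wfty (B a)" using SPi.prems ab unfolding wfty.simps by blast+
  qed
  show ?case
  proof (intro conjI impI)
    assume uv: "per (SPi A B) u v"
    show "per (SPi A B) v u"
      unfolding per.simps
    proof (intro allI impI)
      fix a b assume "per A a b"
      note ab = *[OF this] this
      then have "per (B a) (app u b) (app v a)" using uv by (metis per.simps(3))
      with ab B[of a] show "per (B a) (app v a) (app u b)" by blast
    qed
    assume vw: "per (SPi A B) v w"
    show "per (SPi A B) u w"
      unfolding per.simps
    proof (intro allI impI)
      fix a b assume "per A a b"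
      note ab = *[OF this] this
      have "per (B a) (app u a) (app v a)" "per (B a) (app v a) (app w b)"
        using uv vw ab unfolding per.simps by blast+
      with ab B[of a] show "per (B a) (app u a) (app w b)" by blast
    qed
  qed
qed auto

lemma per_sym: "wfty A \<Longrightarrow> per A u v \<Longrightarrow> per A v u"
  and per_trans: "wfty A \<Longrightarrow> per A u v \<Longrightarrow> per A v w \<Longrightarrow> per A u w"
  using per_sym_trans by blast+

lemma per_refl1: "wfty A \<Longrightarrow> per A u v \<Longrightarrow> per A u u"
  and per_refl2: "wfty A \<Longrightarrow> per A u v \<Longrightarrow> per A v v"
  using per_sym per_trans by blast+

lemma per_class_eq_iff:
  assumes "wfty A" "per A u u"
  shows "{x. per A u x} = {x. per A v x} \<longleftrightarrow> per A u v"
proof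
  assume eq: "{x. per A u x} = {x. per A v x}"
  have "u \<in> {x. per A u x}" using assms(2) by simp
  then have "per A v u" unfolding eq by simp
  with assms(1) show "per A u v" by (rule per_sym)
next
  assume uv: "per A u v"
  show "{x. per A u x} = {x. per A v x}"
    using per_trans[OF assms(1) uv] per_trans[OF assms(1) per_sym[OF assms(1) uv]] by blast
qed

text \<open>Outside its domain the family of a product is reset to \<open>SUniv\<close>, so that
  families agreeing on the domain give the same code.\<close>

primrec tyI :: "expr \<Rightarrow> 'v env \<Rightarrow> 'v sty" where
  "tyI (Var i) \<rho> = SEl (tmI (Var i) \<rho>)"
| "tyI Univ \<rho> = SUniv"
| "tyI (Pi A B) \<rho> =
     SPi (tyI A \<rho>) (\<lambda>a. if per (tyI A \<rho>) a a then tyI B (case_nat a \<rho>) else SUniv)"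
| "tyI (Lam A b) \<rho> = SEl (tmI (Lam A b) \<rho>)"
| "tyI (App c a) \<rho> = SEl (tmI (App c a) \<rho>)"
| "tyI (Id A a b) \<rho> =
     SId (tyI A \<rho>) {x. per (tyI A \<rho>) (tmI a \<rho>) x} {x. per (tyI A \<rho>) (tmI b \<rho>) x}"
| "tyI (Refl a) \<rho> = SEl (tmI (Refl a) \<rho>)"

end

section \<open>Syntactic invariants of terms and identity endpoints\<close>

fun is_term :: "expr \<Rightarrow> bool" where
  "is_term Univ = False"
| "is_term (Pi A B) = False"
| "is_term (Id A a b) = False"
| "is_term e = True"

lemma is_term_lift [simp]: "is_term (lift d k e) = is_term e"
  by (cases e) simp_all

lemma is_term_subst: "is_term s \<Longrightarrow> is_term e \<Longrightarrow> is_term (subst s k e)"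
  by (cases e) simp_all

text \<open>The code of an identity type does not reveal whether its endpoints are terms
  syntactically; this invariant of derivable types keeps that information for equality
  reflection.\<close>

primrec id_args_terms :: "expr \<Rightarrow> bool" where
  "id_args_terms (Var i) = True"
| "id_args_terms Univ = True"
| "id_args_terms (Pi A B) = (id_args_terms A \<and> id_args_terms B)"
| "id_args_terms (Lam A b) = True"
| "id_args_terms (App c a) = True"
| "id_args_terms (Id A a b) = (id_args_terms A \<and> is_term a \<and> is_term b)"
| "id_args_terms (Refl a) = True"

lemma id_args_terms_term: "is_term e \<Longrightarrow> id_args_terms e"
  by (cases e) simp_all

lemma id_args_terms_lift [simp]: "id_args_terms (lift d k e) = id_args_terms e"
  by (induction e arbitrary: k) simp_all

lemma id_args_terms_subst: "is_term s \<Longrightarrow> id_args_terms e \<Longrightarrow> id_args_terms (subst s k e)"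
  by (induction e arbitrary: k) (simp_all add: is_term_subst id_args_terms_term)

context universe_model
begin

lemma tyI_term: "is_term e \<Longrightarrow> tyI e \<rho> = SEl (tmI e \<rho>)"
  by (cases e) simp_all

lemma tyI_lift: "tyI (lift d k e) \<rho> = tyI e (\<lambda>i. \<rho> (if i < k then i else i + d))"
proof (induction e arbitrary: k \<rho>)
  case (Pi A B)
  have *: "(\<lambda>i. case_nat x \<rho> (if i < Suc k then i else i + d)) =
        case_nat x (\<lambda>i. \<rho> (if i < k then i else i + d))" for x
    by (simp add: fun_eq_iff split: nat.split)
  show ?case by (simp add: Pi.IH * cong: if_cong)
next
  case (Lam A b)
  show ?case using tmI_lift[of d k "Lam A b" \<rho>] by simp
qed (simp_all add: tmI_lift)

text \<open>The restriction on \<open>s\<close> matters where a variable used as a type is replaced: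
  the variable means \<open>SEl\<close> of its value, and \<open>s\<close> means the same only if it
  is not a type former.\<close>

lemma tyI_subst: "is_term s \<Longrightarrow> tyI (subst s k e) \<rho> = tyI e (env_inst s k \<rho>)"
proof (induction e arbitrary: k \<rho>)
  case (Var i)
  then show ?case by (simp add: env_inst_def tmI_lift tyI_term)
next
  case (Lam A b)
  show ?case using tmI_subst[of s k "Lam A b" \<rho>] by simp
qed (simp_all add: tmI_subst env_inst_Suc cong: if_cong)

text \<open>Demanding that the two environments agree on the type makes this relation a partial
  equivalence relation for every \<open>\<Gamma>\<close>, well-formed or not.\<close>

primrec ctxI :: "ctx \<Rightarrow> 'v env \<Rightarrow> 'v env \<Rightarrow> bool" where
  "ctxI [] \<rho> \<rho>' = True"
| "ctxI (A # \<Gamma>) \<rho> \<rho>' =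
     (ctxI \<Gamma> (\<lambda>i. \<rho> (Suc i)) (\<lambda>i. \<rho>' (Suc i)) \<and> wfty (tyI A (\<lambda>i. \<rho> (Suc i))) \<and>
      tyI A (\<lambda>i. \<rho> (Suc i)) = tyI A (\<lambda>i. \<rho>' (Suc i)) \<and> per (tyI A (\<lambda>i. \<rho> (Suc i))) (\<rho> 0) (\<rho>' 0))"

lemma ctxI_sym: "ctxI \<Gamma> \<rho> \<rho>' \<Longrightarrow> ctxI \<Gamma> \<rho>' \<rho>"
proof (induction \<Gamma> arbitrary: \<rho> \<rho>')
  case (Cons A \<Gamma>)
  from Cons.prems have h: "ctxI \<Gamma> (\<lambda>i. \<rho> (Suc i)) (\<lambda>i. \<rho>' (Suc i))"
    "wfty (tyI A (\<lambda>i. \<rho> (Suc i)))" "tyI A (\<lambda>i. \<rho> (Suc i)) = tyI A (\<lambda>i. \<rho>' (Suc i))"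
    "per (tyI A (\<lambda>i. \<rho> (Suc i))) (\<rho> 0) (\<rho>' 0)"
    unfolding ctxI.simps(2) by blast+
  show ?case using Cons.IH[OF h(1)] per_sym[OF h(2,4)] h(2) by (simp flip: h(3))
qed simp

lemma ctxI_refl1: "ctxI \<Gamma> \<rho> \<rho>' \<Longrightarrow> ctxI \<Gamma> \<rho> \<rho>"
proof (induction \<Gamma> arbitrary: \<rho> \<rho>')
  case (Cons A \<Gamma>)
  from Cons.prems have h: "ctxI \<Gamma> (\<lambda>i. \<rho> (Suc i)) (\<lambda>i. \<rho>' (Suc i))"
    "wfty (tyI A (\<lambda>i. \<rho> (Suc i)))" "tyI A (\<lambda>i. \<rho> (Suc i)) = tyI A (\<lambda>i. \<rho>' (Suc i))"
    "per (tyI A (\<lambda>i. \<rho> (Suc i))) (\<rho> 0) (\<rho>' 0)"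
    unfolding ctxI.simps(2) by blast+
  show ?case using Cons.IH[OF h(1)] per_refl1[OF h(2,4)] h(2) by simp
qed simp

lemma ctxI_refl2: "ctxI \<Gamma> \<rho> \<rho>' \<Longrightarrow> ctxI \<Gamma> \<rho>' \<rho>'"
  by (rule ctxI_refl1[OF ctxI_sym])

text \<open>Comparing \<open>A\<close> in one environment with \<open>B\<close> in a related one
  builds extensionality in, so that \<open>eqty \<Gamma> A A\<close> is the right meaning of type
  formation.\<close>

definition eqty :: "ctx \<Rightarrow> expr \<Rightarrow> expr \<Rightarrow> bool" where
  "eqty \<Gamma> A B \<longleftrightarrow> id_args_terms A \<and> id_args_terms B \<and>
     (\<forall>\<rho> \<rho>'. ctxI \<Gamma> \<rho> \<rho>' \<longrightarrow> wfty (tyI A \<rho>) \<and> tyI A \<rho> = tyI B \<rho>')"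

definition eqtm :: "ctx \<Rightarrow> expr \<Rightarrow> expr \<Rightarrow> expr \<Rightarrow> bool" where
  "eqtm \<Gamma> a b A \<longleftrightarrow> eqty \<Gamma> A A \<and> is_term a \<and> is_term b \<and>
     (\<forall>\<rho> \<rho>'. ctxI \<Gamma> \<rho> \<rho>' \<longrightarrow> per (tyI A \<rho>) (tmI a \<rho>) (tmI b \<rho>'))"

primrec valid :: "ctx \<Rightarrow> judgement \<Rightarrow> bool" where
  "valid \<Gamma> IsCtx = True"
| "valid \<Gamma> (IsType A) = eqty \<Gamma> A A"
| "valid \<Gamma> (EqType A B) = eqty \<Gamma> A B"
| "valid \<Gamma> (HasType a A) = eqtm \<Gamma> a a A"
| "valid \<Gamma> (EqTerm a b A) = eqtm \<Gamma> a b A"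

section \<open>Equivalence, conversion, weakening and substitution in the model\<close>

declare ctxI.simps(2) [simp del]

lemma eqtyD:
  assumes "eqty \<Gamma> A B"
  shows "id_args_terms A" "id_args_terms B" "ctxI \<Gamma> \<rho> \<rho>' \<Longrightarrow> wfty (tyI A \<rho>)"
    "ctxI \<Gamma> \<rho> \<rho>' \<Longrightarrow> tyI A \<rho> = tyI B \<rho>'"
  using assms unfolding eqty_def by blast+

lemma eqtmD:
  assumes "eqtm \<Gamma> a b A"
  shows "eqty \<Gamma> A A" "is_term a" "is_term b"
    "ctxI \<Gamma> \<rho> \<rho>' \<Longrightarrow> per (tyI A \<rho>) (tmI a \<rho>) (tmI b \<rho>')"
  using assms unfolding eqtm_def by blast+

lemma eqty_sym:
  assumes "eqty \<Gamma> A B"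
  shows "eqty \<Gamma> B A"
  unfolding eqty_def
proof (intro conjI allI impI)
  show "id_args_terms B" "id_args_terms A" using eqtyD(1,2)[OF assms] by simp_all
  fix \<rho> \<rho>' assume "ctxI \<Gamma> \<rho> \<rho>'"
  then have \<rho>: "ctxI \<Gamma> \<rho>' \<rho>" by (rule ctxI_sym)
  show "wfty (tyI B \<rho>)" "tyI B \<rho> = tyI A \<rho>'" using eqtyD(3,4)[OF assms \<rho>] by simp_all
qed

lemma eqty_trans:
  assumes AB: "eqty \<Gamma> A B" and BC: "eqty \<Gamma> B C"
  shows "eqty \<Gamma> A C"
  unfolding eqty_def
proof (intro conjI allI impI)
  show "id_args_terms A" "id_args_terms C" using eqtyD(1,2)[OF AB] eqtyD(1,2)[OF BC] by simp_all
  fix \<rho> \<rho>' assume \<rho>: "ctxI \<Gamma> \<rho> \<rho>'"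
  show "wfty (tyI A \<rho>)" by (rule eqtyD(3)[OF AB \<rho>])
  show "tyI A \<rho> = tyI C \<rho>'" using eqtyD(4)[OF AB \<rho>] eqtyD(4)[OF BC ctxI_refl2[OF \<rho>]] by simp
qed

lemma eqty_refl1: "eqty \<Gamma> A B \<Longrightarrow> eqty \<Gamma> A A"
  by (rule eqty_trans[OF _ eqty_sym])

lemma eqtm_sym:
  assumes "eqtm \<Gamma> a b A"
  shows "eqtm \<Gamma> b a A"
  unfolding eqtm_def
proof (intro conjI allI impI)
  note A = eqtmD(1)[OF assms]
  show "eqty \<Gamma> A A" "is_term b" "is_term a" using eqtmD(1-3)[OF assms] by simp_all
  fix \<rho> \<rho>' assume \<rho>: "ctxI \<Gamma> \<rho> \<rho>'"
  have "per (tyI A \<rho>') (tmI a \<rho>') (tmI b \<rho>)" by (rule eqtmD(4)[OF assms ctxI_sym[OF \<rho>]])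
  with eqtyD(3,4)[OF A \<rho>] show "per (tyI A \<rho>) (tmI b \<rho>) (tmI a \<rho>')"
    using per_sym[of "tyI A \<rho>"] by simp
qed

lemma eqtm_trans:
  assumes ab: "eqtm \<Gamma> a b A" and bc: "eqtm \<Gamma> b c A"
  shows "eqtm \<Gamma> a c A"
  unfolding eqtm_def
proof (intro conjI allI impI)
  note A = eqtmD(1)[OF ab]
  show "eqty \<Gamma> A A" "is_term a" "is_term c" using eqtmD(1-3)[OF ab] eqtmD(3)[OF bc] by simp_all
  fix \<rho> \<rho>' assume \<rho>: "ctxI \<Gamma> \<rho> \<rho>'"
  have "per (tyI A \<rho>') (tmI b \<rho>') (tmI c \<rho>')" by (rule eqtmD(4)[OF bc ctxI_refl2[OF \<rho>]])
  with eqtyD(3,4)[OF A \<rho>] eqtmD(4)[OF ab \<rho>] show "per (tyI A \<rho>) (tmI a \<rho>) (tmI c \<rho>')"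
    using per_trans[of "tyI A \<rho>"] by simp
qed

lemma eqtm_conv:
  assumes ab: "eqtm \<Gamma> a b A" and AB: "eqty \<Gamma> A B"
  shows "eqtm \<Gamma> a b B"
  unfolding eqtm_def
proof (intro conjI allI impI)
  show "eqty \<Gamma> B B" by (rule eqty_refl1[OF eqty_sym[OF AB]])
  show "is_term a" "is_term b" using eqtmD(2,3)[OF ab] by simp_all
  fix \<rho> \<rho>' assume \<rho>: "ctxI \<Gamma> \<rho> \<rho>'"
  from eqtmD(4)[OF ab \<rho>] eqtyD(4)[OF AB ctxI_refl1[OF \<rho>]]
  show "per (tyI B \<rho>) (tmI a \<rho>) (tmI b \<rho>')" by simp
qed

lemma eqtm_refl1: "eqtm \<Gamma> a b A \<Longrightarrow> eqtm \<Gamma> a a A"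
  by (rule eqtm_trans[OF _ eqtm_sym])

lemma ctxI_Cons:
  "eqty \<Gamma> A A \<Longrightarrow> ctxI \<Gamma> \<rho> \<rho>' \<Longrightarrow> per (tyI A \<rho>) u v \<Longrightarrow>
   ctxI (A # \<Gamma>) (case_nat u \<rho>) (case_nat v \<rho>')"
  unfolding ctxI.simps(2) using eqtyD(3,4)[of \<Gamma> A A \<rho> \<rho>'] by simp

lemma ctxI_lift:
  "ctxI (lift_tele \<Delta> @ A # \<Gamma>) \<rho> \<rho>' \<Longrightarrow>
   ctxI (\<Delta> @ \<Gamma>) (\<lambda>i. \<rho> (if i < length \<Delta> then i else i + 1)) (\<lambda>i. \<rho>' (if i < length \<Delta> then i else i + 1))"
proof (induction \<Delta> arbitrary: \<rho> \<rho>')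
  case Nil
  then show ?case by (simp add: ctxI.simps(2))
next
  case (Cons B \<Delta>)
  have *: "(\<lambda>i. \<rho> (if Suc i < Suc k then Suc i else Suc i + 1)) =
    (\<lambda>i. \<rho> (Suc (if i < k then i else i + 1)))" for k and \<rho> :: "'v env"
    by (simp add: fun_eq_iff)
  have **: "(if 0 < Suc k then 0 else 0 + 1) = (0::nat)" for k by simp
  show ?case
    using Cons.prems Cons.IH[of "\<lambda>i. \<rho> (Suc i)" "\<lambda>i. \<rho>' (Suc i)"]
    unfolding lift_tele.simps append_Cons ctxI.simps(2) tyI_lift length_Cons * ** by blast
qed

lemma ctxI_subst:
  assumes a: "eqtm \<Gamma> a a A"
  shows "ctxI (subst_tele a \<Delta> @ \<Gamma>) \<rho> \<rho>' \<Longrightarrow>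
    ctxI (\<Delta> @ A # \<Gamma>) (env_inst a (length \<Delta>) \<rho>) (env_inst a (length \<Delta>) \<rho>')"
proof (induction \<Delta> arbitrary: \<rho> \<rho>')
  case Nil
  then show ?case using a ctxI_Cons[of \<Gamma> A] by (simp add: env_inst_0 eqtmD)
next
  case (Cons B \<Delta>)
  have *: "(\<lambda>i. env_inst a (Suc k) \<rho> (Suc i)) = env_inst a k (\<lambda>i. \<rho> (Suc i))" for k and \<rho> :: "'v env"
    by (auto simp: env_inst_def fun_eq_iff)
  have **: "env_inst a (Suc k) \<rho> 0 = \<rho> 0" for k and \<rho> :: "'v env"
    by (simp add: env_inst_def)
  have "is_term a" using a by (rule eqtmD)
  then show ?case
    using Cons.prems Cons.IH[of "\<lambda>i. \<rho> (Suc i)" "\<lambda>i. \<rho>' (Suc i)"]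
    unfolding subst_tele.simps append_Cons ctxI.simps(2) tyI_subst[OF \<open>is_term a\<close>] length_Cons * ** by blast
qed

lemma valid_weakening:
  assumes "valid (\<Delta> @ \<Gamma>) J"
  shows "valid (lift_tele \<Delta> @ A # \<Gamma>) (map_judgement (lift 1 (length \<Delta>)) J)"
proof -
  have ty: "eqty (lift_tele \<Delta> @ A # \<Gamma>) (lift 1 (length \<Delta>) B) (lift 1 (length \<Delta>) B')"
    if "eqty (\<Delta> @ \<Gamma>) B B'" for B B'
    unfolding eqty_def tyI_lift using eqtyD[OF that] ctxI_lift by (simp, blast)
  have "eqtm (lift_tele \<Delta> @ A # \<Gamma>)
      (lift 1 (length \<Delta>) b) (lift 1 (length \<Delta>) b') (lift 1 (length \<Delta>) B)"
    if "eqtm (\<Delta> @ \<Gamma>) b b' B" for b b' B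
    unfolding eqtm_def tyI_lift tmI_lift using ty eqtmD[OF that] ctxI_lift by auto
  with ty show ?thesis using assms by (cases J) simp_all
qed

lemma valid_substitution:
  assumes "valid (\<Delta> @ A # \<Gamma>) J" "eqtm \<Gamma> a a A"
  shows "valid (subst_tele a \<Delta> @ \<Gamma>) (map_judgement (subst a (length \<Delta>)) J)"
proof -
  have a: "is_term a" using assms(2) by (rule eqtmD)
  have ty: "eqty (subst_tele a \<Delta> @ \<Gamma>) (subst a (length \<Delta>) B) (subst a (length \<Delta>) B')"
    if "eqty (\<Delta> @ A # \<Gamma>) B B'" for B B'
    unfolding eqty_def tyI_subst[OF a]
    using eqtyD[OF that] ctxI_subst[OF assms(2)] id_args_terms_subst[OF a] by blast
  have "eqtm (subst_tele a \<Delta> @ \<Gamma>)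
      (subst a (length \<Delta>) b) (subst a (length \<Delta>) b') (subst a (length \<Delta>) B)"
    if "eqtm (\<Delta> @ A # \<Gamma>) b b' B" for b b' B
    unfolding eqtm_def tyI_subst[OF a] tmI_subst
    using ty eqtmD[OF that] ctxI_subst[OF assms(2)] is_term_subst[OF a] by auto
  with ty show ?thesis using assms(1) by (cases J) simp_all
qed

lemma eqty_inst:
  assumes "eqty (A # \<Gamma>) B B'" "eqtm \<Gamma> a a' A"
  shows "eqty \<Gamma> (inst B a) (inst B' a')"
  unfolding eqty_def
proof (intro conjI allI impI)
  show "id_args_terms (inst B a)" "id_args_terms (inst B' a')"
    using eqtyD[OF assms(1)] eqtmD[OF assms(2)] by (auto intro: id_args_terms_subst)
  fix \<rho> \<rho>' assume "ctxI \<Gamma> \<rho> \<rho>'"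
  with assms(2) have "ctxI (A # \<Gamma>) (case_nat (tmI a \<rho>) \<rho>) (case_nat (tmI a' \<rho>') \<rho>')"
    by (intro ctxI_Cons) (auto simp: eqtmD)
  from eqtyD(3,4)[OF assms(1) this] eqtmD(2,3)[OF assms(2)] show "wfty (tyI (inst B a) \<rho>)" "tyI (inst B a) \<rho> = tyI (inst B' a') \<rho>'"
    by (simp_all add: tyI_subst env_inst_0)
qed

lemma eqtm_inst:
  assumes "eqtm (A # \<Gamma>) b b' B" "eqtm \<Gamma> a a' A"
  shows "eqtm \<Gamma> (inst b a) (inst b' a') (inst B a)"
  unfolding eqtm_def
proof (intro conjI allI impI)
  have t: "is_term a" "is_term a'" "is_term b" "is_term b'" using assms by (auto dest: eqtmD)
  then show "is_term (inst b a)" "is_term (inst b' a')" by (auto intro: is_term_subst)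
  show "eqty \<Gamma> (inst B a) (inst B a)"
    using assms eqtm_refl1 by (intro eqty_inst) (auto dest: eqtmD)
  fix \<rho> \<rho>' assume "ctxI \<Gamma> \<rho> \<rho>'"
  with assms(2) have "ctxI (A # \<Gamma>) (case_nat (tmI a \<rho>) \<rho>) (case_nat (tmI a' \<rho>') \<rho>')"
    by (intro ctxI_Cons) (auto simp: eqtmD)
  from eqtmD(4)[OF assms(1) this] t show "per (tyI (inst B a) \<rho>) (tmI (inst b a) \<rho>) (tmI (inst b' a') \<rho>')"
    by (simp add: tyI_subst tmI_subst env_inst_0)
qed

section \<open>Products in the model\<close>

lemma eqty_Pi:
  assumes A: "eqty \<Gamma> A A'" and B: "eqty (A # \<Gamma>) B B'"
  shows "eqty \<Gamma> (Pi A B) (Pi A' B')"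
  unfolding eqty_def
proof (intro conjI allI impI)
  show "id_args_terms (Pi A B)" "id_args_terms (Pi A' B')"
    using eqtyD(1,2)[OF A] eqtyD(1,2)[OF B] by simp_all
  fix \<rho> \<rho>' assume \<rho>: "ctxI \<Gamma> \<rho> \<rho>'"
  have A1: "eqty \<Gamma> A A" using A by (rule eqty_refl1)
  note w = eqtyD(3)[OF A \<rho>] and eq = eqtyD(4)[OF A \<rho>]
  have BB: "wfty (tyI B (case_nat a \<rho>)) \<and> tyI B (case_nat a \<rho>) = tyI B (case_nat b \<rho>)"
    if "per (tyI A \<rho>) a b" for a b
    using eqtyD(3,4)[OF eqty_refl1[OF B] ctxI_Cons[OF A1 ctxI_refl1[OF \<rho>] that]] by blast
  show "wfty (tyI (Pi A B) \<rho>)"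
    unfolding tyI.simps wfty.simps
  proof (intro conjI allI impI w)
    fix a b assume ab: "per (tyI A \<rho>) a b"
    note p = per_refl1[OF w ab] per_refl2[OF w ab]
    show "(if per (tyI A \<rho>) a a then tyI B (case_nat a \<rho>) else SUniv) =
        (if per (tyI A \<rho>) b b then tyI B (case_nat b \<rho>) else SUniv)"
      "wfty (if per (tyI A \<rho>) a a then tyI B (case_nat a \<rho>) else SUniv)"
      unfolding if_P[OF p(1)] if_P[OF p(2)] using BB[OF ab] by blast+
  qed
  \<comment> \<open>By the reset in \<open>tyI\<close>, the two codes only have to agree at
    arguments in the domain.\<close>
  have "tyI B (case_nat a \<rho>) = tyI B' (case_nat a \<rho>')" if "per (tyI A \<rho>) a a" for a
    by (rule eqtyD(4)[OF B ctxI_Cons[OF A1 \<rho> that]])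
  then show "tyI (Pi A B) \<rho> = tyI (Pi A' B') \<rho>'"
    by (simp flip: eq cong: if_cong)
qed

text \<open>Application and eta start from a term of type \<open>Pi A B\<close>; the validity of the
  parts of that type is recovered from the injectivity of its code.\<close>

lemma eqty_PiD:
  assumes "eqty \<Gamma> (Pi A B) (Pi A B)"
  shows "eqty \<Gamma> A A" "eqty (A # \<Gamma>) B B"
proof -
  show A: "eqty \<Gamma> A A"
    using assms unfolding eqty_def tyI.simps wfty.simps id_args_terms.simps sty.inject by blast
  show "eqty (A # \<Gamma>) B B"
    unfolding eqty_def
  proof (intro conjI allI impI)
    show "id_args_terms B" "id_args_terms B" using eqtyD(1)[OF assms] by simp_all
    fix \<rho> \<rho>' assume \<rho>: "ctxI (A # \<Gamma>) \<rho> \<rho>'"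
    define \<sigma> \<sigma>' where s: "\<sigma> = (\<lambda>i. \<rho> (Suc i))" "\<sigma>' = (\<lambda>i. \<rho>' (Suc i))"
    have e: "\<rho> = case_nat (\<rho> 0) \<sigma>" "\<rho>' = case_nat (\<rho>' 0) \<sigma>'"
      by (auto simp: s fun_eq_iff split: nat.split)
    have p: "ctxI \<Gamma> \<sigma> \<sigma>'" "per (tyI A \<sigma>) (\<rho> 0) (\<rho>' 0)" "wfty (tyI A \<sigma>)" "tyI A \<sigma> = tyI A \<sigma>'"
      using \<rho> unfolding s ctxI.simps(2) by blast+
    then have p': "per (tyI A \<sigma>) (\<rho> 0) (\<rho> 0)" "per (tyI A \<sigma>) (\<rho>' 0) (\<rho>' 0)"
      using per_refl1 per_refl2 by blast+
    have P: "wfty (tyI (Pi A B) \<sigma>)" "tyI (Pi A B) \<sigma> = tyI (Pi A B) \<sigma>'"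
      using eqtyD(3,4)[OF assms p(1)] .
    from P(1) have "\<forall>a b. per (tyI A \<sigma>) a b \<longrightarrow>
        (if per (tyI A \<sigma>) a a then tyI B (case_nat a \<sigma>) else SUniv) =
        (if per (tyI A \<sigma>) b b then tyI B (case_nat b \<sigma>) else SUniv) \<and>
        wfty (if per (tyI A \<sigma>) a a then tyI B (case_nat a \<sigma>) else SUniv)"
      unfolding tyI.simps wfty.simps by blast
    from this[rule_format, OF p(2)] p' have 1: "wfty (tyI B (case_nat (\<rho> 0) \<sigma>))"
      "tyI B (case_nat (\<rho> 0) \<sigma>) = tyI B (case_nat (\<rho>' 0) \<sigma>)"
      unfolding if_P[OF p'(1)] if_P[OF p'(2)] by blast+
    \<comment> \<open>So far the argument has moved from \<open>\<rho> 0\<close> to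
      \<open>\<rho>' 0\<close> over \<open>\<sigma>\<close>; equality of the two product codes now
      moves \<open>\<sigma>\<close> to \<open>\<sigma>'\<close> at a fixed argument.\<close>
    from P(2) have "(if per (tyI A \<sigma>) a a then tyI B (case_nat a \<sigma>) else SUniv) =
      (if per (tyI A \<sigma>) a a then tyI B (case_nat a \<sigma>') else SUniv)" for a
      using p(4) by (simp add: fun_eq_iff)
    from this[of "\<rho>' 0"] have "tyI B (case_nat (\<rho>' 0) \<sigma>) = tyI B (case_nat (\<rho>' 0) \<sigma>')"
      using p'(2) by simp
    with 1 e show "wfty (tyI B \<rho>)" "tyI B \<rho> = tyI B \<rho>'" by simp_all
  qed
qed

lemma per_Pi:
  assumes "wfty (tyI A \<rho>)"
  shows "per (tyI (Pi A B) \<rho>) u v \<longleftrightarrow>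
    (\<forall>a b. per (tyI A \<rho>) a b \<longrightarrow> per (tyI B (case_nat a \<rho>)) (app u a) (app v b))"
proof -
  have "per (if per (tyI A \<rho>) a a then tyI B (case_nat a \<rho>) else SUniv) =
      per (tyI B (case_nat a \<rho>))" if "per (tyI A \<rho>) a b" for a b
    using per_refl1[OF assms that] by simp
  then show ?thesis unfolding tyI.simps per.simps by (metis (no_types))
qed

lemma eqtm_Lam:
  assumes A: "eqty \<Gamma> A A'" and b: "eqtm (A # \<Gamma>) b b' B"
  shows "eqtm \<Gamma> (Lam A b) (Lam A' b') (Pi A B)"
  unfolding eqtm_def
proof (intro conjI allI impI)
  have A1: "eqty \<Gamma> A A" using A by (rule eqty_refl1)
  then show "eqty \<Gamma> (Pi A B) (Pi A B)" using b by (intro eqty_Pi) (auto dest: eqtmD)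
  fix \<rho> \<rho>' assume \<rho>: "ctxI \<Gamma> \<rho> \<rho>'"
  note w = eqtyD(3)[OF A \<rho>]
  show "per (tyI (Pi A B) \<rho>) (tmI (Lam A b) \<rho>) (tmI (Lam A' b') \<rho>')"
    unfolding per_Pi[OF w]
  proof (intro allI impI)
    fix u v assume "per (tyI A \<rho>) u v"
    with A1 \<rho> have "ctxI (A # \<Gamma>) (case_nat u \<rho>) (case_nat v \<rho>')" by (rule ctxI_Cons)
    from eqtmD(4)[OF b this] show "per (tyI B (case_nat u \<rho>)) (app (tmI (Lam A b) \<rho>) u) (app (tmI (Lam A' b') \<rho>') v)"
      by (simp add: app_lam_tmI)
  qed
qed simp_all

lemma eqtm_App:
  assumes c: "eqtm \<Gamma> c c' (Pi A B)" and a: "eqtm \<Gamma> a a' A"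
  shows "eqtm \<Gamma> (App c a) (App c' a') (inst B a)"
  unfolding eqtm_def
proof (intro conjI allI impI)
  have AB: "eqty \<Gamma> A A" "eqty (A # \<Gamma>) B B" using eqty_PiD[OF eqtmD(1)[OF c]] .
  show "eqty \<Gamma> (inst B a) (inst B a)" using AB eqtm_refl1[OF a] by (intro eqty_inst)
  fix \<rho> \<rho>' assume \<rho>: "ctxI \<Gamma> \<rho> \<rho>'"
  note w = eqtyD(3)[OF AB(1) \<rho>]
  have "per (tyI (Pi A B) \<rho>) (tmI c \<rho>) (tmI c' \<rho>')" "per (tyI A \<rho>) (tmI a \<rho>) (tmI a' \<rho>')"
    using eqtmD(4)[OF c \<rho>] eqtmD(4)[OF a \<rho>] .
  then show "per (tyI (inst B a) \<rho>) (tmI (App c a) \<rho>) (tmI (App c' a') \<rho>')"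
    using eqtmD(2)[OF a] unfolding per_Pi[OF w] by (simp add: tyI_subst env_inst_0)
qed simp_all

lemma eqtm_beta:
  assumes b: "eqtm (A # \<Gamma>) b b B" and a: "eqtm \<Gamma> a a A"
  shows "eqtm \<Gamma> (App (Lam A b) a) (inst b a) (inst B a)"
proof -
  have "is_term a" using a by (simp add: eqtm_def)
  then have "tmI (App (Lam A b) a) \<rho> = tmI (inst b a) \<rho>" for \<rho> :: "'v env"
    by (simp add: app_lam_tmI tmI_subst env_inst_0)
  with eqtm_inst[OF assms] show ?thesis by (simp add: eqtm_def)
qed

text \<open>The graph model is not extensional, but the relation of a product only looks at
  applications, and there both sides agree by semantic beta.\<close>

lemma eqtm_eta:
  assumes c: "eqtm \<Gamma> c c (Pi A B)"
  shows "eqtm \<Gamma> (Lam A (App (weaken c) (Var 0))) c (Pi A B)"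
  unfolding eqtm_def
proof (intro conjI allI impI)
  show P: "eqty \<Gamma> (Pi A B) (Pi A B)" and "is_term c" using c by (auto dest: eqtmD)
  fix \<rho> \<rho>' assume \<rho>: "ctxI \<Gamma> \<rho> \<rho>'"
  note w = eqtyD(3)[OF eqty_PiD(1)[OF P] \<rho>]
  have "app (tmI (Lam A (App (weaken c) (Var 0))) \<rho>) u = app (tmI c \<rho>) u" for u
    using app_lam_tmI[of "App (weaken c) (Var 0)" \<rho> u] by (simp add: tmI_lift)
  moreover have "per (tyI (Pi A B) \<rho>) (tmI c \<rho>) (tmI c \<rho>')"
    by (rule eqtmD(4)[OF c \<rho>])
  ultimately show "per (tyI (Pi A B) \<rho>) (tmI (Lam A (App (weaken c) (Var 0))) \<rho>) (tmI c \<rho>')"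
    unfolding per_Pi[OF w] by simp
qed simp

section \<open>Identity types in the model\<close>

lemma eqty_Id:
  assumes A: "eqty \<Gamma> A B" and a: "eqtm \<Gamma> a b A" and a': "eqtm \<Gamma> a' b' A"
  shows "eqty \<Gamma> (Id A a a') (Id B b b')"
  unfolding eqty_def
proof (intro conjI allI impI)
  show "id_args_terms (Id A a a')" "id_args_terms (Id B b b')"
    using eqtyD(1,2)[OF A] eqtmD(2,3)[OF a] eqtmD(2,3)[OF a'] by simp_all
  fix \<rho> \<rho>' assume \<rho>: "ctxI \<Gamma> \<rho> \<rho>'"
  note w = eqtyD(3)[OF A \<rho>] and eq = eqtyD(4)[OF A \<rho>, symmetric]
  have p: "per (tyI A \<rho>) (tmI a \<rho>) (tmI b \<rho>')" "per (tyI A \<rho>) (tmI a' \<rho>) (tmI b' \<rho>')"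
    using eqtmD(4)[OF a \<rho>] eqtmD(4)[OF a' \<rho>] .
  then have "{x. per (tyI A \<rho>) (tmI a \<rho>) x} = {x. per (tyI A \<rho>) (tmI b \<rho>') x}"
    "{x. per (tyI A \<rho>) (tmI a' \<rho>) x} = {x. per (tyI A \<rho>) (tmI b' \<rho>') x}"
    using w per_refl1 per_class_eq_iff by blast+
  then show "wfty (tyI (Id A a a') \<rho>)" "tyI (Id A a a') \<rho> = tyI (Id B b b') \<rho>'"
    using w p by (auto simp: eq)
qed

lemma eqtm_Refl:
  assumes "eqtm \<Gamma> a a' A"
  shows "eqtm \<Gamma> (Refl a) (Refl a') (Id A a a)"
  using eqty_Id[of \<Gamma> A A a a a a] eqtm_refl1[OF assms] by (simp add: eqtm_def)

text \<open>Nonempty classes make the endpoints related to themselves; equality of the codes in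
  related environments then relates each endpoint across the two.\<close>

lemma eqty_IdD:
  assumes "eqty \<Gamma> (Id A a a') (Id A a a')" "ctxI \<Gamma> \<rho> \<rho>'"
  shows "wfty (tyI A \<rho>)" "tyI A \<rho> = tyI A \<rho>'"
    "per (tyI A \<rho>) (tmI a \<rho>) (tmI a \<rho>')" "per (tyI A \<rho>) (tmI a' \<rho>) (tmI a' \<rho>')"
proof -
  note I = eqtyD(3,4)[OF assms]
  then show w: "wfty (tyI A \<rho>)" and eq: "tyI A \<rho> = tyI A \<rho>'" by simp_all
  obtain x y where "per (tyI A \<rho>) (tmI a \<rho>) x" "per (tyI A \<rho>) (tmI a' \<rho>) y"
    using I(1) by auto
  then have p: "per (tyI A \<rho>) (tmI a \<rho>) (tmI a \<rho>)" "per (tyI A \<rho>) (tmI a' \<rho>) (tmI a' \<rho>)"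
    using w per_refl1 by blast+
  then show "per (tyI A \<rho>) (tmI a \<rho>) (tmI a \<rho>')" "per (tyI A \<rho>) (tmI a' \<rho>) (tmI a' \<rho>')"
    using I(2) per_class_eq_iff[OF w p(1)] per_class_eq_iff[OF w p(2)] by (simp_all flip: eq)
qed

text \<open>An identity type has an element only if the classes of its endpoints coincide, which by
  \<open>per_class_eq_iff\<close> means that the endpoints are related.\<close>

lemma eqtm_reflection:
  assumes c: "eqtm \<Gamma> c c (Id A a a')"
  shows "eqtm \<Gamma> a a' A"
proof -
  have I: "eqty \<Gamma> (Id A a a') (Id A a a')" using c by (rule eqtmD)
  have "per (tyI A \<rho>) (tmI a \<rho>) (tmI a' \<rho>')" if \<rho>: "ctxI \<Gamma> \<rho> \<rho>'" for \<rho> \<rho>'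
  proof -
    note D = eqty_IdD[OF I ctxI_refl1[OF \<rho>]] eqty_IdD[OF I \<rho>]
    have "{x. per (tyI A \<rho>) (tmI a \<rho>) x} = {x. per (tyI A \<rho>) (tmI a' \<rho>) x}"
      using eqtmD(4)[OF c \<rho>] by simp
    then have "per (tyI A \<rho>) (tmI a \<rho>) (tmI a' \<rho>)"
      using D per_class_eq_iff by blast
    with D show ?thesis using per_trans by blast
  qed
  moreover have "eqty \<Gamma> A A"
    using eqtyD(1)[OF I] eqty_IdD(1,2)[OF I] by (simp add: eqty_def)
  ultimately show ?thesis using eqtyD(1)[OF I] by (simp add: eqtm_def)
qed

lemma eqtm_Id_unique:
  assumes "eqtm \<Gamma> c c (Id A a a')"
  shows "eqtm \<Gamma> c (Refl a) (Id A a a')"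
  unfolding eqtm_def
proof (intro conjI allI impI)
  show I: "eqty \<Gamma> (Id A a a') (Id A a a')" and "is_term c" using assms by (auto dest: eqtmD)
  fix \<rho> \<rho>' assume "ctxI \<Gamma> \<rho> \<rho>'"
  from eqtmD(4)[OF assms this] show "per (tyI (Id A a a') \<rho>) (tmI c \<rho>) (tmI (Refl a) \<rho>')"
    by simp
qed simp

section \<open>The universe and soundness\<close>

lemma eqty_El:
  assumes "eqtm \<Gamma> a b Univ"
  shows "eqty \<Gamma> a b"
  unfolding eqty_def
proof (intro conjI allI impI)
  note t = eqtmD(2,3)[OF assms]
  then show "id_args_terms a" "id_args_terms b" by (simp_all add: id_args_terms_term)
  fix \<rho> \<rho>' assume "ctxI \<Gamma> \<rho> \<rho>'"
  \<comment> \<open>Related elements of \<open>SUniv\<close> are the same singleton, so the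
    \<open>SEl\<close> codes built from them are equal.\<close>
  from eqtmD(4)[OF assms this] show "wfty (tyI a \<rho>)" "tyI a \<rho> = tyI b \<rho>'"
    using t by (auto simp: tyI_term)
qed

theorem soundness: "\<Gamma> \<turnstile> J \<Longrightarrow> valid \<Gamma> J"
proof (induction rule: deriv.induct)
  case (weakening \<Delta> \<Gamma> J A)
  then show ?case by (intro valid_weakening)
next
  case (substitution \<Delta> A \<Gamma> J a)
  then show ?case by (intro valid_substitution) simp_all
next
  case (var \<Gamma> A)
  then have A: "eqty \<Gamma> A A" by simp
  have v: "tyI A (\<lambda>i. \<rho> (Suc i)) = tyI A (\<lambda>i. \<rho>' (Suc i))" "wfty (tyI A (\<lambda>i. \<rho> (Suc i)))"
      "per (tyI A (\<lambda>i. \<rho> (Suc i))) (\<rho> 0) (\<rho>' 0)" if "ctxI (A # \<Gamma>) \<rho> \<rho>'" for \<rho> \<rho>'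
    using that unfolding ctxI.simps(2) by blast+
  have "eqty (A # \<Gamma>) (weaken A) (weaken A)"
    unfolding eqty_def tyI_lift using eqtyD(1)[OF A] v by simp
  then show ?case
    unfolding valid.simps eqtm_def tyI_lift using v by simp
next
  case (type_sym \<Gamma> A B)
  then show ?case by (simp add: eqty_sym)
next
  case (type_trans \<Gamma> A B C)
  then show ?case using eqty_trans by auto
next
  case (term_sym \<Gamma> a b A)
  then show ?case by (simp add: eqtm_sym)
next
  case (term_trans \<Gamma> a b A c)
  then show ?case using eqtm_trans by auto
next
  case (conv \<Gamma> a A B)
  then show ?case by (auto intro: eqtm_conv)
next
  case (conv_eq \<Gamma> a a' A B)
  then show ?case by (auto intro: eqtm_conv)
next
  case (univ_form \<Gamma>)
  then show ?case by (simp add: eqty_def)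
next
  case (univ_el \<Gamma> X)
  then show ?case by (simp add: eqty_El)
next
  case (univ_el_cong \<Gamma> X X')
  then show ?case by (simp add: eqty_El)
next
  case (subst_cong_type A \<Gamma> B a a')
  then show ?case by (simp add: eqty_inst)
next
  case (subst_cong_term A \<Gamma> b B a a')
  then show ?case by (simp add: eqtm_inst)
next
  case (pi_form \<Gamma> A B)
  then show ?case by (simp add: eqty_Pi del: tyI.simps)
next
  case (pi_form_cong \<Gamma> A A' B B')
  then show ?case by (simp add: eqty_Pi)
next
  case (pi_intro \<Gamma> A b B)
  then show ?case by (simp add: eqtm_Lam)
next
  case (pi_intro_cong \<Gamma> A A' b b' B)
  then show ?case by (simp add: eqtm_Lam)
next
  case (pi_elim \<Gamma> c A B a)
  then show ?case by (simp add: eqtm_App)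
next
  case (pi_elim_cong \<Gamma> c c' A B a a')
  then show ?case by (simp add: eqtm_App)
next
  case (pi_beta \<Gamma> A b B a)
  then show ?case by (simp add: eqtm_beta)
next
  case (pi_eta \<Gamma> c A B)
  then show ?case by (simp add: eqtm_eta del: One_nat_def)
next
  case (id_form \<Gamma> A a a')
  then show ?case by (simp add: eqty_Id)
next
  case (id_form_cong \<Gamma> A B a b a' b')
  then show ?case by (simp add: eqty_Id)
next
  case (id_intro \<Gamma> a A)
  then show ?case by (simp add: eqtm_Refl)
next
  case (id_intro_cong \<Gamma> a a' A)
  then show ?case by (simp add: eqtm_Refl)
next
  case (id_reflection \<Gamma> c A a a')
  then show ?case by (auto intro: eqtm_reflection)
next
  case (id_unique \<Gamma> c A a a')
  then show ?case by (simp add: eqtm_Id_unique)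
qed simp_all

end

subsection \<open>Horn theories as contexts\<close>

lemma lift_0 [simp]: "lift 0 k e = e"
  by (induction e arbitrary: k) simp_all

lemma lift_lift: "c \<le> j \<Longrightarrow> j \<le> c + e \<Longrightarrow> lift d j (lift e c t) = lift (e + d) c t"
  by (induction t arbitrary: c j) simp_all

lemma subst_lift: "c \<le> k \<Longrightarrow> k \<le> c + d \<Longrightarrow> subst s k (lift (Suc d) c t) = lift d c t"
  by (induction t arbitrary: c k) auto

lemma subst_lift_same [simp]: "subst s k (lift (Suc 0) k t) = t"
  using subst_lift[of k k 0 s t] by simp

lemma subst_lift_commute:
  "j \<le> k \<Longrightarrow> subst s (Suc k) (lift (Suc 0) j t) = lift (Suc 0) j (subst s k t)"
  by (induction t arbitrary: j k) (auto simp: lift_lift)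

lemma lift_lift_commute:
  "j \<le> k \<Longrightarrow> lift d (Suc k) (lift (Suc 0) j t) = lift (Suc 0) j (lift d k t)"
  by (induction t arbitrary: j k) auto

primrec pis :: "nat \<Rightarrow> expr \<Rightarrow> expr" where
  "pis 0 B = B"
| "pis (Suc n) B = Pi Univ (pis n B)"

primrec imps :: "expr list \<Rightarrow> expr \<Rightarrow> expr" where
  "imps [] Q = Q"
| "imps (P # Ps) Q = Pi P (weaken (imps Ps Q))"

text \<open>The head of the list replaces the outermost variable, which has the highest index; this
  is the order in which applications instantiate \<open>pis\<close>.\<close>

primrec insts :: "expr \<Rightarrow> expr list \<Rightarrow> expr" where
  "insts B [] = B"
| "insts B (t # ts) = insts (subst t (length ts) B) ts"

lemma lift_pis [simp]: "lift d k (pis n B) = pis n (lift d (k + n) B)"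
  by (induction n arbitrary: k) simp_all

lemma subst_pis [simp]: "subst s k (pis n B) = pis n (subst s (k + n) B)"
  by (induction n arbitrary: k) simp_all

lemma lift_imps: "lift d k (imps Ps Q) = imps (map (lift d k) Ps) (lift d k Q)"
  by (induction Ps) (simp_all add: lift_lift_commute)

lemma subst_imps: "subst s k (imps Ps Q) = imps (map (subst s k) Ps) (subst s k Q)"
  by (induction Ps) (simp_all add: subst_lift_commute)

lemma insts_App [simp]: "insts (App c a) ts = App (insts c ts) (insts a ts)"
  by (induction ts arbitrary: c a) simp_all

lemma insts_Id [simp]: "insts (Id A a b) ts = Id (insts A ts) (insts a ts) (insts b ts)"
  by (induction ts arbitrary: A a b) simp_all

lemma insts_Univ [simp]: "insts Univ ts = Univ"
  by (induction ts) simp_all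

lemma insts_imps: "insts (imps Ps Q) ts = imps (map (\<lambda>P. insts P ts) Ps) (insts Q ts)"
  by (induction ts arbitrary: Ps Q) (simp_all add: subst_imps comp_def)

lemma insts_lift: "insts (lift (length ts) 0 t) ts = t"
  by (induction ts) (simp_all add: subst_lift)

lemma insts_Var_lt: "i < length ts \<Longrightarrow> insts (Var i) ts = rev ts ! i"
  by (induction ts) (auto simp: insts_lift nth_append)

lemma insts_Var_ge: "insts (Var (length ts + i)) ts = Var i"
  by (induction ts) simp_all

lemma deriv_weaken:
  assumes "\<Gamma> \<turnstile> IsType B"
  shows "\<Gamma> \<turnstile> HasType a A \<Longrightarrow> B # \<Gamma> \<turnstile> HasType (weaken a) (weaken A)"
    and "\<Gamma> \<turnstile> IsType A \<Longrightarrow> B # \<Gamma> \<turnstile> IsType (weaken A)"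
  using weakening[of "[]" \<Gamma> _ B] assms by force+

lemma deriv_pis: "replicate m Univ @ \<Gamma> \<turnstile> IsType B \<Longrightarrow> \<Gamma> \<turnstile> IsCtx \<Longrightarrow> \<Gamma> \<turnstile> IsType (pis m B)"
proof (induction m arbitrary: \<Gamma>)
  case (Suc m)
  then have "Univ # \<Gamma> \<turnstile> IsCtx" by (intro ctx_ext univ_form)
  with Suc show ?case by (auto simp: replicate_app_Cons_same intro: pi_form univ_form)
qed simp

lemma deriv_imps:
  "\<forall>P\<in>set Ps. \<Gamma> \<turnstile> IsType P \<Longrightarrow> \<Gamma> \<turnstile> IsType Q \<Longrightarrow> \<Gamma> \<turnstile> IsType (imps Ps Q)"
  by (induction Ps) (auto simp del: One_nat_def intro: pi_form deriv_weaken)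

lemma deriv_pis_elim:
  "\<Gamma> \<turnstile> HasType c (pis (length ts) B) \<Longrightarrow> \<forall>t\<in>set ts. \<Gamma> \<turnstile> HasType t Univ \<Longrightarrow>
   \<exists>c'. \<Gamma> \<turnstile> HasType c' (insts B ts)"
proof (induction ts arbitrary: c B)
  case (Cons t ts)
  then have "\<Gamma> \<turnstile> HasType (App c t) (inst (pis (length ts) B) t)"
    by (intro pi_elim[of _ _ Univ]) simp_all
  then show ?case using Cons by simp
qed auto

lemma deriv_imps_elim:
  "\<Gamma> \<turnstile> HasType c (imps Ps Q) \<Longrightarrow> \<forall>P\<in>set Ps. \<exists>p. \<Gamma> \<turnstile> HasType p P \<Longrightarrow> \<exists>q. \<Gamma> \<turnstile> HasType q Q"
proof (induction Ps arbitrary: c)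
  case (Cons P Ps)
  then obtain p where "\<Gamma> \<turnstile> HasType p P" by auto
  with Cons.prems have "\<Gamma> \<turnstile> HasType (App c p) (inst (weaken (imps Ps Q)) p)"
    by (intro pi_elim) simp_all
  then show ?case using Cons by simp
qed auto

section \<open>First-order terms and clauses as expressions\<close>

datatype tm = TV nat | Leaf | Node tm tm

type_synonym atom = "tm \<times> tm \<times> tm"

primrec tvars :: "tm \<Rightarrow> nat set" where
  "tvars (TV i) = {i}"
| "tvars Leaf = {}"
| "tvars (Node a b) = tvars a \<union> tvars b"

primrec tsubst :: "(nat \<Rightarrow> tm) \<Rightarrow> tm \<Rightarrow> tm" where
  "tsubst \<sigma> (TV i) = \<sigma> i"
| "tsubst \<sigma> Leaf = Leaf"
| "tsubst \<sigma> (Node a b) = Node (tsubst \<sigma> a) (tsubst \<sigma> b)"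

fun avars :: "atom \<Rightarrow> nat set" where
  "avars (a, b, c) = tvars a \<union> tvars b \<union> tvars c"

fun asubst :: "(nat \<Rightarrow> tm) \<Rightarrow> atom \<Rightarrow> atom" where
  "asubst \<sigma> (a, b, c) = (tsubst \<sigma> a, tsubst \<sigma> b, tsubst \<sigma> c)"

text \<open>The signature: a ternary relation, a binary and a constant symbol; \<open>d\<close> is the de Bruijn index
  of the first one. Elements of \<open>Univ\<close> serve both as data and as propositions.\<close>

definition sig :: ctx where
  "sig = [pis 3 Univ, pis 2 Univ, Univ]"

primrec emb :: "(nat \<Rightarrow> expr) \<Rightarrow> nat \<Rightarrow> tm \<Rightarrow> expr" where
  "emb v d (TV i) = v i"
| "emb v d Leaf = Var (d + 2)"
| "emb v d (Node a b) = App (App (Var (d + 1)) (emb v d a)) (emb v d b)"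

fun emb_atom :: "(nat \<Rightarrow> expr) \<Rightarrow> nat \<Rightarrow> atom \<Rightarrow> expr" where
  "emb_atom v d (a, b, c) = App (App (App (Var d) (emb v d a)) (emb v d b)) (emb v d c)"

text \<open>The conclusion is an arbitrary expression because one axiom concludes in an identity
  type. Under the \<open>m\<close> bound variables the signature starts at index
  \<open>m\<close>.\<close>

definition rule_type :: "nat \<Rightarrow> atom list \<Rightarrow> expr \<Rightarrow> expr" where
  "rule_type m ps Q = pis m (imps (map (emb_atom Var m) ps) Q)"

definition sig_at :: "ctx \<Rightarrow> nat \<Rightarrow> bool" where
  "sig_at \<Gamma> d \<longleftrightarrow> \<Gamma> \<turnstile> IsCtx \<and> \<Gamma> \<turnstile> HasType (Var d) (pis 3 Univ) \<and>
     \<Gamma> \<turnstile> HasType (Var (d + 1)) (pis 2 Univ) \<and> \<Gamma> \<turnstile> HasType (Var (d + 2)) Univ"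

lemma sig_at_Cons: "sig_at \<Gamma> d \<Longrightarrow> \<Gamma> \<turnstile> IsType A \<Longrightarrow> sig_at (A # \<Gamma>) (Suc d)"
  using deriv_weaken(1)[of \<Gamma> A "Var d" "pis 3 Univ"]
    deriv_weaken(1)[of \<Gamma> A "Var (d + 1)" "pis 2 Univ"] deriv_weaken(1)[of \<Gamma> A "Var (d + 2)" Univ]
  by (simp add: sig_at_def ctx_ext)

lemma sig_at_sig: "sig_at sig 0"
proof -
  have 0: "[] \<turnstile> IsType Univ" by (intro univ_form ctx_empty)
  have c1: "[Univ] \<turnstile> IsCtx" using ctx_ext[OF ctx_empty 0] .
  have pisU: "\<Gamma> \<turnstile> IsType (pis n Univ)" if "\<Gamma> \<turnstile> IsCtx" for \<Gamma> n
  proof (rule deriv_pis[OF _ that])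
    have "replicate n Univ @ \<Gamma> \<turnstile> IsCtx" using that
      by (induction n) (auto intro: ctx_ext univ_form)
    then show "replicate n Univ @ \<Gamma> \<turnstile> IsType Univ" by (rule univ_form)
  qed
  have v1: "[Univ] \<turnstile> HasType (Var 0) Univ" using var[OF ctx_empty 0] by simp
  note t2 = pisU[OF c1, of 2]
  have c2: "[pis 2 Univ, Univ] \<turnstile> IsCtx" using ctx_ext[OF c1 t2] .
  have v2: "[pis 2 Univ, Univ] \<turnstile> HasType (Var 0) (pis 2 Univ)"
    "[pis 2 Univ, Univ] \<turnstile> HasType (Var 1) Univ"
    using var[OF c1 t2] deriv_weaken(1)[OF t2 v1] by simp_all
  note t3 = pisU[OF c2, of 3]
  have "[pis 3 Univ, pis 2 Univ, Univ] \<turnstile> IsCtx" using ctx_ext[OF c2 t3] .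
  moreover have "[pis 3 Univ, pis 2 Univ, Univ] \<turnstile> HasType (Var 0) (pis 3 Univ)"
    "[pis 3 Univ, pis 2 Univ, Univ] \<turnstile> HasType (Var 1) (pis 2 Univ)"
    "[pis 3 Univ, pis 2 Univ, Univ] \<turnstile> HasType (Var 2) Univ"
    using var[OF c2 t3] deriv_weaken(1)[OF t3 v2(1)] deriv_weaken(1)[OF t3 v2(2)]
    by (simp_all add: numeral_2_eq_2)
  ultimately show ?thesis by (simp add: sig_at_def sig_def numeral_2_eq_2)
qed

lemma deriv_App_pis:
  "\<Gamma> \<turnstile> HasType c (pis (Suc n) Univ) \<Longrightarrow> \<Gamma> \<turnstile> HasType a Univ \<Longrightarrow> \<Gamma> \<turnstile> HasType (App c a) (pis n Univ)"
  using pi_elim[of \<Gamma> c Univ "pis n Univ" a] by simp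

lemma deriv_emb:
  assumes "sig_at \<Gamma> d"
  shows "\<forall>i\<in>tvars t. \<Gamma> \<turnstile> HasType (v i) Univ \<Longrightarrow> \<Gamma> \<turnstile> HasType (emb v d t) Univ"
proof (induction t)
  case (Node a b)
  then have "\<Gamma> \<turnstile> HasType (App (App (Var (d + 1)) (emb v d a)) (emb v d b)) (pis 0 Univ)"
    using assms unfolding sig_at_def by (intro deriv_App_pis) (simp_all add: numeral_2_eq_2)
  then show ?case by simp
qed (use assms in \<open>simp_all add: sig_at_def\<close>)

lemma deriv_emb_atom:
  assumes "sig_at \<Gamma> d" "\<forall>i\<in>avars p. \<Gamma> \<turnstile> HasType (v i) Univ"
  shows "\<Gamma> \<turnstile> HasType (emb_atom v d p) Univ"
proof (cases p)
  case (fields a b c)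
  then have "\<Gamma> \<turnstile> HasType (emb_atom v d p) (pis 0 Univ)"
    using assms deriv_emb[OF assms(1)] unfolding sig_at_def emb_atom.simps fields
    by (intro deriv_App_pis) (simp_all add: numeral_3_eq_3)
  then show ?thesis by simp
qed

lemma sig_at_replicate:
  "sig_at (replicate m Univ @ sig) m"
  "i < m \<Longrightarrow> replicate m Univ @ sig \<turnstile> HasType (Var i) Univ"
proof (induction m arbitrary: i)
  case 0
  case 1 show ?case using sig_at_sig by simp
  case 2 then show ?case by simp
next
  case (Suc m)
  have U: "replicate m Univ @ sig \<turnstile> IsType Univ"
    using Suc.IH(1) by (auto simp: sig_at_def intro: univ_form)
  case 1 show ?case using sig_at_Cons[OF Suc.IH(1) U] by simp
  case 2 show ?case
  proof (cases i)
    case 0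
    then show ?thesis using var[OF _ U] Suc.IH(1) by (simp add: sig_at_def)
  next
    case (Suc j)
    then show ?thesis using deriv_weaken(1)[OF U Suc.IH(2)[of j]] 2 by simp
  qed
qed

lemma deriv_rule_type:
  assumes "\<forall>p\<in>set ps. avars p \<subseteq> {..<m}" "replicate m Univ @ sig \<turnstile> IsType Q"
  shows "sig \<turnstile> IsType (rule_type m ps Q)"
  unfolding rule_type_def
proof (intro deriv_pis deriv_imps ballI)
  show "sig \<turnstile> IsCtx" using sig_at_sig by (simp add: sig_at_def)
  fix P assume "P \<in> set (map (emb_atom Var m) ps)"
  then show "replicate m Univ @ sig \<turnstile> IsType P"
    using assms(1) by (auto intro!: univ_el deriv_emb_atom[OF sig_at_replicate(1)] sig_at_replicate(2))
qed (rule assms(2))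

text \<open>Every axiom is a type over \<open>sig\<close> alone, so it is lifted past the axioms
  below it and depends on none of them.\<close>

primrec horn_ctx :: "expr list \<Rightarrow> ctx" where
  "horn_ctx [] = sig"
| "horn_ctx (A # As) = lift (length As) 0 A # horn_ctx As"

lemma horn_ctx_IsType:
  assumes "\<forall>A\<in>set As. sig \<turnstile> IsType A" "sig \<turnstile> IsType B"
  shows "horn_ctx As \<turnstile> IsType (lift (length As) 0 B)"
  using assms
proof (induction As arbitrary: B)
  case (Cons A As)
  then have "lift (length As) 0 A # horn_ctx As \<turnstile> IsType (weaken (lift (length As) 0 B))"
    by (intro deriv_weaken) simp_all
  then show ?case by (simp add: lift_lift)
qed simp

lemma sig_at_horn_ctx: "\<forall>A\<in>set As. sig \<turnstile> IsType A \<Longrightarrow> sig_at (horn_ctx As) (length As)"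
  by (induction As) (auto intro!: sig_at_Cons sig_at_sig horn_ctx_IsType)

lemma horn_ctx_member:
  assumes "\<forall>A\<in>set As. sig \<turnstile> IsType A" "A \<in> set As"
  shows "\<exists>p. horn_ctx As \<turnstile> HasType p (lift (length As) 0 A)"
  using assms
proof (induction As)
  case (Cons B As)
  have B: "horn_ctx As \<turnstile> IsType (lift (length As) 0 B)"
    using Cons.prems by (intro horn_ctx_IsType) simp_all
  show ?case
  proof (cases "A = B")
    case True
    have "horn_ctx As \<turnstile> IsCtx" using sig_at_horn_ctx Cons.prems by (simp add: sig_at_def)
    from var[OF this B] True show ?thesis by (auto simp: lift_lift)
  next
    case False
    then obtain p where "horn_ctx As \<turnstile> HasType p (lift (length As) 0 A)" using Cons by auto
    from deriv_weaken(1)[OF B this] show ?thesis by (auto simp: lift_lift)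
  qed
qed simp

text \<open>Made total by sending every variable to the constant symbol, which has index
  \<open>length As + 2\<close> in \<open>horn_ctx As\<close>.\<close>

definition ground :: "expr list \<Rightarrow> tm \<Rightarrow> expr" where
  "ground As = emb (\<lambda>_. Var (length As + 2)) (length As)"

definition ground_atom :: "expr list \<Rightarrow> atom \<Rightarrow> expr" where
  "ground_atom As = emb_atom (\<lambda>_. Var (length As + 2)) (length As)"

text \<open>Reversed because \<open>insts\<close> starts with the variable of highest index.\<close>

definition valuation :: "nat \<Rightarrow> expr list \<Rightarrow> (nat \<Rightarrow> tm) \<Rightarrow> expr list" where
  "valuation m As \<sigma> = rev (map (\<lambda>i. ground As (\<sigma> i)) [0..<m])"

lemma length_valuation [simp]: "length (valuation m As \<sigma>) = m"
  by (simp add: valuation_def)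

lemma insts_emb:
  "tvars t \<subseteq> {..<m} \<Longrightarrow>
   insts (lift (length As) m (emb Var m t)) (valuation m As \<sigma>) = ground As (tsubst \<sigma> t)"
proof (induction t)
  case (TV i)
  then show ?case by (simp add: insts_Var_lt) (simp add: valuation_def)
qed (use insts_Var_ge[of "valuation m As \<sigma>"] in \<open>simp_all add: ground_def add.assoc del: add_Suc_right add_2_eq_Suc'\<close>)

lemma insts_emb_atom:
  "avars p \<subseteq> {..<m} \<Longrightarrow>
   insts (lift (length As) m (emb_atom Var m p)) (valuation m As \<sigma>) = ground_atom As (asubst \<sigma> p)"
  using insts_Var_ge[of "valuation m As \<sigma>" "length As"] insts_emb[of _ m As \<sigma>]
  by (cases p) (simp add: ground_atom_def ground_def)

lemma deriv_ground_atom: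
  "\<forall>A\<in>set As. sig \<turnstile> IsType A \<Longrightarrow> horn_ctx As \<turnstile> HasType (ground_atom As p) Univ"
  "\<forall>A\<in>set As. sig \<turnstile> IsType A \<Longrightarrow> horn_ctx As \<turnstile> HasType (ground As t) Univ"
  unfolding ground_atom_def ground_def using sig_at_horn_ctx[of As]
  by (auto intro!: deriv_emb_atom deriv_emb simp: sig_at_def)

text \<open>An axiom used as an inference: its variable is applied to the terms of the valuation and
  then to proofs of the premises.\<close>

lemma rule_type_elim:
  assumes As: "\<forall>A\<in>set As. sig \<turnstile> IsType A" and mem: "rule_type m ps Q \<in> set As"
    and vars: "\<forall>p\<in>set ps. avars p \<subseteq> {..<m}"
    and prems: "\<forall>p\<in>set ps. \<exists>e. horn_ctx As \<turnstile> HasType e (ground_atom As (asubst \<sigma> p))"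
  shows "\<exists>e. horn_ctx As \<turnstile> HasType e (insts (lift (length As) m Q) (valuation m As \<sigma>))"
proof -
  let ?ts = "valuation m As \<sigma>"
  from horn_ctx_member[OF As mem] obtain c where
    "horn_ctx As \<turnstile> HasType c (pis (length ?ts) (lift (length As) m (imps (map (emb_atom Var m) ps) Q)))"
    by (auto simp: rule_type_def)
  moreover have "\<forall>t\<in>set ?ts. horn_ctx As \<turnstile> HasType t Univ"
    using deriv_ground_atom(2)[OF As] by (auto simp: valuation_def)
  ultimately obtain c' where
    "horn_ctx As \<turnstile> HasType c' (insts (lift (length As) m (imps (map (emb_atom Var m) ps) Q)) ?ts)"
    using deriv_pis_elim by blast
  then show ?thesis
    unfolding lift_imps insts_imps
    by (rule deriv_imps_elim) (use prems vars insts_emb_atom in auto)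
qed

subsection \<open>Models of Horn theories\<close>

text \<open>Atoms are first-order terms and only \<open>Leaf\<close> counts as true. A true
  proposition thus has the same value as the constant symbol, as the reflection axiom
  demands.\<close>

interpretation tm_model: universe_model "{Leaf}" .

text \<open>The empty set is a uniform witness: applied to anything it gives \<open>{}\<close>, and
  it is related to itself in an \<open>SEl\<close> or \<open>SId\<close> type as soon as anything
  is.\<close>

abbreviation inhabited :: "expr \<Rightarrow> tm env \<Rightarrow> bool" where
  "inhabited A \<rho> \<equiv> tm_model.per (tm_model.tyI A \<rho>) {} {}"

definition truth_value :: "bool \<Rightarrow> tm" where
  "truth_value b = (if b then Leaf else Node Leaf Leaf)"

lemma truth_value_eq_Leaf [simp]: "truth_value b = Leaf \<longleftrightarrow> b"
  by (simp add: truth_value_def)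

section \<open>Denotations of the signature and validity of clauses\<close>

definition graph :: "('v \<Rightarrow> 'v elem set) \<Rightarrow> 'v elem set" where
  "graph F = {Arr [Atom a] b | a b. b \<in> F a}"

lemma app_graph [simp]: "app (graph F) {Atom a} = F a"
proof
  show "app (graph F) {Atom a} \<subseteq> F a" by (auto simp: app_def graph_def)
  show "F a \<subseteq> app (graph F) {Atom a}"
  proof
    fix b assume "b \<in> F a"
    then have "set [Atom a] \<subseteq> {Atom a} \<and> Arr [Atom a] b \<in> graph F" by (simp add: graph_def)
    then show "b \<in> app (graph F) {Atom a}" unfolding app_def by blast
  qed
qed

definition node_den :: "tm elem set" where
  "node_den = graph (\<lambda>a. graph (\<lambda>b. {Atom (Node a b)}))"

definition rel_den :: "(atom \<Rightarrow> bool) \<Rightarrow> tm elem set" where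
  "rel_den R = graph (\<lambda>a. graph (\<lambda>b. graph (\<lambda>c. {Atom (truth_value (R (a, b, c)))})))"

definition sig_env :: "(atom \<Rightarrow> bool) \<Rightarrow> tm env" where
  "sig_env R = case_nat (rel_den R) (case_nat node_den (case_nat {Atom Leaf} (\<lambda>_. {})))"

definition sig_env_at :: "(atom \<Rightarrow> bool) \<Rightarrow> tm env \<Rightarrow> nat \<Rightarrow> bool" where
  "sig_env_at R \<rho> d \<longleftrightarrow> \<rho> d = rel_den R \<and> \<rho> (d + 1) = node_den \<and> \<rho> (d + 2) = {Atom Leaf}"

lemma tmI_emb:
  assumes "sig_env_at R \<rho> d"
  shows "\<forall>i\<in>tvars t. tmI (v i) \<rho> = {Atom (\<sigma> i)} \<Longrightarrow> tmI (emb v d t) \<rho> = {Atom (tsubst \<sigma> t)}"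
  using assms by (induction t) (simp_all add: sig_env_at_def node_den_def)

lemma tmI_emb_atom:
  assumes "sig_env_at R \<rho> d" "\<forall>i\<in>avars p. tmI (v i) \<rho> = {Atom (\<sigma> i)}"
  shows "tmI (emb_atom v d p) \<rho> = {Atom (truth_value (R (asubst \<sigma> p)))}"
  using assms tmI_emb[OF assms(1), of _ v \<sigma>]
  by (cases p) (simp add: sig_env_at_def rel_den_def)

text \<open>The elements of \<open>SUniv\<close> are the singletons of atoms, so quantifying over
  \<open>Univ\<close> amounts to quantifying over assignments of first-order terms.\<close>

lemma inhabited_pis:
  assumes "\<And>\<sigma>. inhabited B (\<lambda>i. if i < m then {Atom (\<sigma> i)} else \<rho> (i - m))"
  shows "inhabited (pis m B) \<rho>"
  using assms
proof (induction m arbitrary: \<rho>)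
  case (Suc m)
  have "inhabited (pis m B) (case_nat {Atom x} \<rho>)" for x
  proof (rule Suc.IH)
    fix \<sigma>
    \<comment> \<open>The binder just removed is the outermost one, hence its value \<open>x\<close>
      belongs to index \<open>m\<close>.\<close>
    have "(\<lambda>i. if i < m then {Atom (\<sigma> i)} else case_nat {Atom x} \<rho> (i - m)) =
      (\<lambda>i. if i < Suc m then {Atom ((\<sigma>(m := x)) i)} else \<rho> (i - Suc m))"
      by (auto simp: fun_eq_iff less_Suc_eq Suc_diff_Suc split: nat.split) (metis Suc_diff_Suc old.nat.inject linorder_neqE_nat)+
    then show "inhabited B (\<lambda>i. if i < m then {Atom (\<sigma> i)} else case_nat {Atom x} \<rho> (i - m))"
      using Suc.prems[of "\<sigma>(m := x)"] by simp
  qed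
  then show ?case unfolding pis.simps by (subst tm_model.per_Pi) auto
qed simp

text \<open>A false premise denotes an empty relation, and under a true one the witness
  \<open>{}\<close> is passed on.\<close>

lemma inhabited_imps:
  assumes "\<forall>P\<in>set Ps. is_term P"
    and "\<forall>P\<in>set Ps. tmI P \<rho> = {Atom Leaf} \<Longrightarrow> inhabited Q \<rho>"
  shows "inhabited (imps Ps Q) \<rho>"
  using assms
proof (induction Ps)
  case (Cons P Ps)
  have "inhabited (imps Ps Q) \<rho>" if "tmI P \<rho> = {Atom Leaf}"
    using Cons that by simp
  moreover have P: "tm_model.tyI P \<rho> = SEl (tmI P \<rho>)"
    using Cons.prems(1) by (intro tm_model.tyI_term) simp
  then have w: "tm_model.wfty (tm_model.tyI P \<rho>)" by simp
  ultimately show ?case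
    unfolding imps.simps tm_model.per_Pi[OF w] by (simp add: P tm_model.tyI_lift)
qed simp

lemma inhabited_rule_type:
  assumes "\<forall>p\<in>set ps. avars p \<subseteq> {..<m}"
    and Q: "\<And>\<rho> \<sigma>. sig_env_at R \<rho> m \<Longrightarrow> \<forall>i<m. \<rho> i = {Atom (\<sigma> i)} \<Longrightarrow> \<forall>p\<in>set ps. R (asubst \<sigma> p) \<Longrightarrow>
      inhabited Q \<rho>"
  shows "inhabited (rule_type m ps Q) (sig_env R)"
  unfolding rule_type_def
proof (intro inhabited_pis inhabited_imps)
  fix \<sigma> :: "nat \<Rightarrow> tm"
  define \<rho> where "\<rho> = (\<lambda>i. if i < m then {Atom (\<sigma> i)} else sig_env R (i - m))"
  have \<rho>: "sig_env_at R \<rho> m" "\<forall>i<m. \<rho> i = {Atom (\<sigma> i)}"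
    by (simp_all add: \<rho>_def sig_env_at_def sig_env_def)
  assume "\<forall>P\<in>set (map (emb_atom Var m) ps).
    tmI P (\<lambda>i. if i < m then {Atom (\<sigma> i)} else sig_env R (i - m)) = {Atom Leaf}"
  then have *: "\<forall>p\<in>set ps. tmI (emb_atom Var m p) \<rho> = {Atom Leaf}" by (simp add: \<rho>_def)
  have "R (asubst \<sigma> p)" if "p \<in> set ps" for p
  proof -
    have "tmI (emb_atom Var m p) \<rho> = {Atom (truth_value (R (asubst \<sigma> p)))}"
      using \<rho>(2) assms(1) that by (intro tmI_emb_atom[OF \<rho>(1)]) auto
    moreover have "tmI (emb_atom Var m p) \<rho> = {Atom Leaf}" using * that by blast
    ultimately have "truth_value (R (asubst \<sigma> p)) = Leaf" by simp
    then show ?thesis by simp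
  qed
  with \<rho> Q have "inhabited Q \<rho>" by blast
  then show "inhabited Q (\<lambda>i. if i < m then {Atom (\<sigma> i)} else sig_env R (i - m))"
    by (simp add: \<rho>_def)
qed auto

text \<open>The first \<open>n\<close> entries are the axioms, all witnessed by
  \<open>{}\<close>.\<close>

definition horn_env :: "(atom \<Rightarrow> bool) \<Rightarrow> nat \<Rightarrow> tm env" where
  "horn_env R n i = (if i < n then {} else sig_env R (i - n))"

lemma ctxI_sig: "tm_model.ctxI sig (sig_env R) (sig_env R)"
  by (auto simp: sig_def sig_env_def tm_model.ctxI.simps(2) numeral_2_eq_2 numeral_3_eq_3
      node_den_def rel_den_def)

lemma ctxI_horn_ctx:
  assumes "\<forall>A\<in>set As. sig \<turnstile> IsType A \<and> inhabited A (sig_env R)"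
  shows "tm_model.ctxI (horn_ctx As) (horn_env R (length As)) (horn_env R (length As))"
  using assms
proof (induction As)
  case Nil
  then show ?case using ctxI_sig by (simp add: horn_env_def[abs_def])
next
  case (Cons A As)
  have *: "(\<lambda>i. horn_env R (length As) (i + length As)) = sig_env R"
    "(\<lambda>i. horn_env R (Suc (length As)) (Suc i)) = horn_env R (length As)"
    by (simp_all add: horn_env_def fun_eq_iff)
  have "tm_model.eqty sig A A" using tm_model.soundness[of sig "IsType A"] Cons.prems by simp
  from tm_model.eqtyD(3)[OF this ctxI_sig]
  have "tm_model.wfty (tm_model.tyI A (sig_env R))" .
  then show ?case
    using Cons by (simp add: tm_model.ctxI.simps(2) tm_model.tyI_lift *) (simp add: horn_env_def)
qed

subsection \<open>Evaluation of partial recursive functions as a Horn theory\<close>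

primrec num :: "nat \<Rightarrow> tm" where
  "num 0 = Leaf"
| "num (Suc n) = Node Leaf (num n)"

text \<open>Numerals and lists overlap as terms; the program in an atom determines how the other
  components are read.\<close>

primrec nums :: "nat list \<Rightarrow> tm" where
  "nums [] = Leaf"
| "nums (x # xs) = Node (num x) (nums xs)"

definition tag :: "nat \<Rightarrow> tm \<Rightarrow> tm" where
  "tag k t = Node (num k) t"

text \<open>Tags 0 to 5 mark the constructors of \<open>recfun\<close>, 6 and 7 lists of programs, and 8 the
  bounded part of a search.\<close>

primrec prog_list :: "tm list \<Rightarrow> tm" where
  "prog_list [] = tag 6 Leaf"
| "prog_list (g # gs) = tag 7 (Node g (prog_list gs))"

primrec prog :: "recfun \<Rightarrow> tm" where
  "prog Zero = tag 0 Leaf"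
| "prog Succ = tag 1 Leaf"
| "prog (Proj i) = tag 2 (num i)"
| "prog (Compose f gs) = tag 3 (Node (prog f) (prog_list (map prog gs)))"
| "prog (PrimRec f g) = tag 4 (Node (prog f) (prog g))"
| "prog (Minimize f) = tag 5 (prog f)"

lemma num_inject [simp]: "num m = num n \<longleftrightarrow> m = n"
proof (induction m arbitrary: n)
  case 0
  show ?case by (cases n) simp_all
next
  case (Suc m)
  then show ?case by (cases n) simp_all
qed

lemma num_eq_simps [simp]:
  "Leaf = num k \<longleftrightarrow> k = 0" "num k = Leaf \<longleftrightarrow> k = 0"
  "Node a b = num k \<longleftrightarrow> (\<exists>j. k = Suc j \<and> a = Leaf \<and> b = num j)"
  by (cases k; auto)+

lemma nums_eq_simps [simp]:
  "Leaf = nums xs \<longleftrightarrow> xs = []"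
  "Node a b = nums xs \<longleftrightarrow> (\<exists>x ys. xs = x # ys \<and> a = num x \<and> b = nums ys)"
  by (cases xs; auto)+

lemma tag_simps [simp]:
  "tag k t = tag k' t' \<longleftrightarrow> k = k' \<and> t = t'"
  "tsubst \<sigma> (tag k t) = tag k (tsubst \<sigma> t)"
  "tvars (tag k t) = tvars t"
proof -
  have "tsubst \<sigma> (num k) = num k" "tvars (num k) = {}" by (induction k) simp_all
  then show "tsubst \<sigma> (tag k t) = tag k (tsubst \<sigma> t)" "tvars (tag k t) = tvars t"
    by (simp_all add: tag_def)
qed (simp add: tag_def)

text \<open>Inversion by tag: it reduces an obligation about a tagged program to the single
  constructor with that tag.\<close>

lemma tag_eq_prog:
  "tag k t = prog f \<longleftrightarrow>
     k = 0 \<and> t = Leaf \<and> f = Zero \<or> k = 1 \<and> t = Leaf \<and> f = Succ \<or>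
     (\<exists>i. k = 2 \<and> t = num i \<and> f = Proj i) \<or>
     (\<exists>h gs. k = 3 \<and> t = Node (prog h) (prog_list (map prog gs)) \<and> f = Compose h gs) \<or>
     (\<exists>h g. k = 4 \<and> t = Node (prog h) (prog g) \<and> f = PrimRec h g) \<or>
     (\<exists>h. k = 5 \<and> t = prog h \<and> f = Minimize h)"
  by (cases f) auto

lemma tag_eq_prog_list:
  "tag k t = prog_list (map prog gs) \<longleftrightarrow>
     k = 6 \<and> t = Leaf \<and> gs = [] \<or>
     (\<exists>h hs. k = 7 \<and> t = Node (prog h) (prog_list (map prog hs)) \<and> gs = h # hs)"
  by (cases gs) auto

text \<open>The six variables are the source of the 6 in later statements. A projection walks down
  the argument list, and a composition first evaluates its list of inner programs. An atom with
  program \<open>tag 8 f\<close> and arguments \<open>Node n xs\<close> asserts that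
  \<open>f\<close> is positive at every number below \<open>n\<close>.\<close>

definition clauses :: "(atom list \<times> atom) list" where
  "clauses = (let f = TV 0; g = TV 1; n = TV 2; xs = TV 3; y = TV 4; z = TV 5; suc = Node Leaf in
    [([], (tag 0 Leaf, xs, Leaf)),
     ([], (tag 1 Leaf, Node n Leaf, suc n)),
     ([], (tag 2 Leaf, Node n xs, n)),
     ([(tag 2 n, xs, y)], (tag 2 (suc n), Node z xs, y)),
     ([], (tag 6 Leaf, xs, Leaf)),
     ([(f, xs, y), (g, xs, z)], (tag 7 (Node f g), xs, Node y z)),
     ([(g, xs, y), (f, y, z)], (tag 3 (Node f g), xs, z)),
     ([(f, xs, y)], (tag 4 (Node f g), Node Leaf xs, y)),
     ([(tag 4 (Node f g), Node n xs, y), (g, Node n (Node y xs), z)],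
        (tag 4 (Node f g), Node (suc n) xs, z)),
     ([], (tag 8 f, Node Leaf xs, Leaf)),
     ([(tag 8 f, Node n xs, Leaf), (f, Node n xs, suc y)], (tag 8 f, Node (suc n) xs, Leaf)),
     ([(tag 8 f, Node n xs, Leaf), (f, Node n xs, Leaf)], (tag 5 f, xs, n))])"

lemma clauses_vars: "(ps, q) \<in> set clauses \<Longrightarrow> p \<in> set (q # ps) \<Longrightarrow> avars p \<subseteq> {..<6}"
  by (auto simp: clauses_def Let_def)

section \<open>Closed relations contain evaluation\<close>

context
  fixes R :: "atom \<Rightarrow> bool"
  assumes closed: "\<And>ps q \<sigma>. (ps, q) \<in> set clauses \<Longrightarrow> \<forall>p\<in>set ps. R (asubst \<sigma> p) \<Longrightarrow> R (asubst \<sigma> q)"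
begin

lemma clause_intros:
  "R (tag 0 Leaf, xs, Leaf)"
  "R (tag 1 Leaf, Node n Leaf, Node Leaf n)"
  "R (tag 2 Leaf, Node n xs, n)"
  "R (tag 2 n, xs, y) \<Longrightarrow> R (tag 2 (Node Leaf n), Node z xs, y)"
  "R (tag 6 Leaf, xs, Leaf)"
  "R (f, xs, y) \<Longrightarrow> R (g, xs, z) \<Longrightarrow> R (tag 7 (Node f g), xs, Node y z)"
  "R (g, xs, y) \<Longrightarrow> R (f, y, z) \<Longrightarrow> R (tag 3 (Node f g), xs, z)"
  "R (f, xs, y) \<Longrightarrow> R (tag 4 (Node f g), Node Leaf xs, y)"
  "R (tag 4 (Node f g), Node n xs, y) \<Longrightarrow> R (g, Node n (Node y xs), z) \<Longrightarrow>
     R (tag 4 (Node f g), Node (Node Leaf n) xs, z)"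
  "R (tag 8 f, Node Leaf xs, Leaf)"
  "R (tag 8 f, Node n xs, Leaf) \<Longrightarrow> R (f, Node n xs, Node Leaf y) \<Longrightarrow>
     R (tag 8 f, Node (Node Leaf n) xs, Leaf)"
  "R (tag 8 f, Node n xs, Leaf) \<Longrightarrow> R (f, Node n xs, Leaf) \<Longrightarrow> R (tag 5 f, xs, n)"
  \<comment> \<open>The list gives the values of \<open>TV 0\<close> to \<open>TV 5\<close>, in the
    order in which \<open>clauses\<close> names them.\<close>
  using closed[of _ _ "(!) [f, g, n, xs, y, z]"]
  by (force simp: clauses_def Let_def)+

lemma computes_imp_closed: "computes f xs y \<Longrightarrow> R (prog f, nums xs, num y)"
proof (induction rule: computes.induct)
  case (Proj i xs)
  then show ?case
  proof (induction xs arbitrary: i)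
    case (Cons x xs)
    then show ?case by (cases i) (auto intro: clause_intros)
  qed simp
next
  case (Compose xs gs ys f z)
  from Compose(1) have "R (prog_list (map prog gs), nums xs, nums ys)"
    by (induction rule: list_all2_induct) (auto intro: clause_intros)
  with Compose show ?case by (auto intro: clause_intros)
next
  case (Minimize f n xs)
  \<comment> \<open>The bounded search climbs up to \<open>n\<close>, each step using a positive
    value of \<open>f\<close>.\<close>
  have "R (tag 8 (prog f), Node (num k) (nums xs), Leaf)" if "k \<le> n" for k
    using that
  proof (induction k)
    case (Suc k)
    moreover from Suc.prems have "k < n" by simp
    with Minimize(3) obtain y where "R (prog f, nums (k # xs), num (Suc y))" by blast
    ultimately show ?case by (auto intro: clause_intros)
  qed (auto intro: clause_intros)
  with Minimize(2) show ?case by (auto intro: clause_intros)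
qed (auto intro: clause_intros simp del: One_nat_def)

end

text \<open>Clause variables range over all first-order terms, so an atom whose first two components
  encode no program with arguments is true vacuously. In a bounded search the bound is required to
  be a numeral, because \<open>Minimize\<close> returns it as its value.\<close>

definition runs :: "atom \<Rightarrow> bool" where
  "runs = (\<lambda>(u, v, w).
    (\<forall>f xs. u = prog f \<and> v = nums xs \<longrightarrow> (\<exists>y. w = num y \<and> computes f xs y)) \<and>
    (\<forall>gs xs. u = prog_list (map prog gs) \<and> v = nums xs \<longrightarrow>
      (\<exists>ys. w = nums ys \<and> list_all2 (\<lambda>g y. computes g xs y) gs ys)) \<and>
    (\<forall>f m xs. u = tag 8 (prog f) \<and> v = Node m (nums xs) \<longrightarrow>
      (\<exists>n. m = num n \<and> (\<forall>k<n. \<exists>y. computes f (k # xs) (Suc y)))))"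

lemma runsD:
  "runs (prog f, nums xs, w) \<Longrightarrow> \<exists>y. w = num y \<and> computes f xs y"
  "runs (prog_list (map prog gs), nums xs, w) \<Longrightarrow>
     \<exists>ys. w = nums ys \<and> list_all2 (\<lambda>g y. computes g xs y) gs ys"
  "runs (tag 8 (prog f), Node m (nums xs), w) \<Longrightarrow>
     \<exists>n. m = num n \<and> (\<forall>k<n. \<exists>y. computes f (k # xs) (Suc y))"
  unfolding runs_def by blast+

lemma runs_PrimRec_Suc:
  assumes "runs (tag 4 (Node f g), Node n xs, y)" "runs (g, Node n (Node y xs), z)"
  shows "runs (tag 4 (Node f g), Node (Node Leaf n) xs, z)"
proof -
  have "\<exists>k. z = num k \<and> computes (PrimRec f' g') (Suc m # ms) k"
    if [simp]: "f = prog f'" "g = prog g'" "n = num m" "xs = nums ms" for f' g' m ms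
  proof -
    obtain k where k: "y = num k" "computes (PrimRec f' g') (m # ms) k"
      using runsD(1)[of "PrimRec f' g'" "m # ms" y] assms(1) by auto
    moreover obtain l where "z = num l" "computes g' (m # k # ms) l"
      using runsD(1)[of g' "m # k # ms" z] assms(2) k(1) by auto
    ultimately show ?thesis by (auto intro: computes.intros)
  qed
  then show ?thesis by (auto simp: runs_def tag_eq_prog tag_eq_prog_list)
qed

lemma runs_search_Suc:
  assumes "runs (tag 8 f, Node n xs, w)" "runs (f, Node n xs, Node Leaf y)"
  shows "runs (tag 8 f, Node (Node Leaf n) xs, w')"
proof -
  have "\<exists>k. Node Leaf n = num k \<and> (\<forall>j<k. \<exists>y. computes f' (j # ms) (Suc y))"
    if [simp]: "f = prog f'" "xs = nums ms" for f' ms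
  proof -
    obtain m where m: "n = num m" "\<forall>j<m. \<exists>y. computes f' (j # ms) (Suc y)"
      using runsD(3)[of f' n ms w] assms(1) by auto
    moreover obtain l where "computes f' (m # ms) (Suc l)"
      using runsD(1)[of f' "m # ms" "Node Leaf y"] assms(2) m(1) by auto
    ultimately show ?thesis by (intro exI[of _ "Suc m"]) (auto simp: less_Suc_eq)
  qed
  then show ?thesis by (auto simp: runs_def tag_eq_prog tag_eq_prog_list)
qed

lemma runs_Minimize:
  assumes "runs (tag 8 f, Node n xs, w)" "runs (f, Node n xs, Leaf)"
  shows "runs (tag 5 f, xs, n)"
proof -
  have "\<exists>k. n = num k \<and> computes (Minimize f') ms k" if [simp]: "f = prog f'" "xs = nums ms" for f' ms
  proof -
    obtain m where m: "n = num m" "\<forall>j<m. \<exists>y. computes f' (j # ms) (Suc y)"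
      using runsD(3)[of f' n ms w] assms(1) by auto
    moreover have "computes f' (m # ms) 0"
      using runsD(1)[of f' "m # ms" Leaf] assms(2) m(1) by auto
    ultimately show ?thesis by (auto intro: computes.intros)
  qed
  then show ?thesis by (auto simp: runs_def tag_eq_prog tag_eq_prog_list)
qed

lemma runs_intros:
  "runs (tag 0 Leaf, xs, Leaf)"
  "runs (tag 1 Leaf, Node n Leaf, Node Leaf n)"
  "runs (tag 2 Leaf, Node n xs, n)"
  "runs (tag 6 Leaf, xs, Leaf)"
  "runs (tag 8 f, Node Leaf xs, Leaf)"
  by (auto simp: runs_def tag_eq_prog tag_eq_prog_list nums_eq_simps(1)[of "[]"] intro: computes.intros
      computes.Proj[of 0 "x # xs" for x xs, simplified])

lemma runs_Proj:
  assumes "runs (tag 2 n, xs, y)"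
  shows "runs (tag 2 (Node Leaf n), Node z xs, y)"
proof -
  have "\<exists>k. y = num k \<and> computes (Proj (Suc i)) (m # ms) k" if [simp]: "n = num i" "xs = nums ms" for i m ms
  proof -
    obtain k where "y = num k" "computes (Proj i) ms k"
      using runsD(1)[of "Proj i" ms y] assms by auto
    then show ?thesis using computes.Proj[of "Suc i" "m # ms"] by (auto elim: computes.cases)
  qed
  then show ?thesis by (auto simp: runs_def tag_eq_prog tag_eq_prog_list)
qed

lemma runs_Cons:
  assumes "runs (f, xs, y)" "runs (g, xs, z)"
  shows "runs (tag 7 (Node f g), xs, Node y z)"
proof -
  have "\<exists>ys. Node y z = nums ys \<and> list_all2 (\<lambda>g y. computes g ms y) (h # hs) ys"
    if [simp]: "f = prog h" "g = prog_list (map prog hs)" "xs = nums ms" for h hs ms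
    using runsD(1)[of h ms y] runsD(2)[of hs ms z] assms by auto
  then show ?thesis by (auto simp: runs_def tag_eq_prog tag_eq_prog_list)
qed

lemma runs_Compose:
  assumes "runs (g, xs, y)" "runs (f, y, z)"
  shows "runs (tag 3 (Node f g), xs, z)"
proof -
  have "\<exists>k. z = num k \<and> computes (Compose h hs) ms k"
    if [simp]: "f = prog h" "g = prog_list (map prog hs)" "xs = nums ms" for h hs ms
    using runsD(2)[of hs ms y] runsD(1)[of h _ z] assms by (fastforce intro: computes.Compose)
  then show ?thesis by (auto simp: runs_def tag_eq_prog tag_eq_prog_list)
qed

lemma runs_PrimRec_0:
  assumes "runs (f, xs, y)"
  shows "runs (tag 4 (Node f g), Node Leaf xs, y)"
proof -
  have "\<exists>k. y = num k \<and> computes (PrimRec f' g') (0 # ms) k" if [simp]: "f = prog f'" "xs = nums ms"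
    for f' g' ms
    using runsD(1)[of f' ms y] assms by (auto intro: computes.PrimRec_0)
  then show ?thesis by (auto simp: runs_def tag_eq_prog tag_eq_prog_list)
qed

lemma runs_clauses:
  "(ps, q) \<in> set clauses \<Longrightarrow> \<forall>p\<in>set ps. runs (asubst \<sigma> p) \<Longrightarrow> runs (asubst \<sigma> q)"
  by (auto simp: clauses_def Let_def simp del: One_nat_def intro: runs_intros runs_Proj runs_Cons runs_Compose
      runs_PrimRec_0 runs_PrimRec_Suc runs_search_Suc runs_Minimize)

subsection \<open>Adequacy\<close>

definition query :: atom where
  "query = (TV 0, TV 1, TV 2)"

text \<open>The head is the reflection axiom: a provable atom equals the constant symbol, which is
  \<open>Var 8\<close> under six variables.\<close>

definition rules :: "expr list" where
  "rules = rule_type 6 [query] (Id Univ (emb_atom Var 6 query) (Var 8)) #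
     map (\<lambda>(ps, q). rule_type 6 ps (emb_atom Var 6 q)) clauses"

lemma query_vars: "avars query \<subseteq> {..<6}"
  by (simp add: query_def)

lemma sig_rules: "\<forall>A\<in>set rules. sig \<turnstile> IsType A"
proof -
  have atom: "replicate 6 Univ @ sig \<turnstile> HasType (emb_atom Var 6 p) Univ" if "avars p \<subseteq> {..<6}" for p
    using that by (intro deriv_emb_atom[OF sig_at_replicate(1)] ballI sig_at_replicate(2)) auto
  have "sig \<turnstile> IsType (rule_type 6 [query] (Id Univ (emb_atom Var 6 query) (Var 8)))"
    using query_vars sig_at_replicate(1)[of 6]
    by (intro deriv_rule_type id_form univ_form atom) (simp_all add: sig_at_def)
  moreover have "sig \<turnstile> IsType (rule_type 6 ps (emb_atom Var 6 q))" if "(ps, q) \<in> set clauses" for ps q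
    using clauses_vars[OF that] by (intro deriv_rule_type univ_el atom) auto
  ultimately show ?thesis by (auto simp: rules_def)
qed

abbreviation leaf_var :: expr where
  "leaf_var \<equiv> Var (length rules + 2)"

lemma rules_closed:
  assumes "(ps, q) \<in> set clauses" "\<forall>p\<in>set ps. \<exists>e. horn_ctx rules \<turnstile> HasType e (ground_atom rules (asubst \<sigma> p))"
  shows "\<exists>e. horn_ctx rules \<turnstile> HasType e (ground_atom rules (asubst \<sigma> q))"
proof -
  have vars: "\<forall>p\<in>set ps. avars p \<subseteq> {..<6}" "avars q \<subseteq> {..<6}" using clauses_vars[OF assms(1)] by auto
  have "rule_type 6 ps (emb_atom Var 6 q) \<in> set rules"
    using assms(1) by (force simp: rules_def)
  from rule_type_elim[OF sig_rules this vars(1) assms(2)] show ?thesis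
    by (simp add: insts_emb_atom[OF vars(2)])
qed

lemma inhabited_rules: "\<forall>A\<in>set rules. inhabited A (sig_env runs)"
proof -
  have "inhabited (rule_type 6 ps (emb_atom Var 6 q)) (sig_env runs)" if c: "(ps, q) \<in> set clauses" for ps q
  proof (rule inhabited_rule_type)
    show "\<forall>p\<in>set ps. avars p \<subseteq> {..<6}" using clauses_vars[OF c] by auto
    fix \<rho> \<sigma> assume \<rho>: "sig_env_at runs \<rho> 6" "\<forall>i<6. \<rho> i = {Atom (\<sigma> i)}"
      and ps: "\<forall>p\<in>set ps. runs (asubst \<sigma> p)"
    have "tmI (emb_atom Var 6 q) \<rho> = {Atom (truth_value (runs (asubst \<sigma> q)))}"
      using \<rho>(2) clauses_vars[OF c, of q] by (intro tmI_emb_atom[OF \<rho>(1)]) auto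
    with runs_clauses[OF c ps] show "inhabited (emb_atom Var 6 q) \<rho>"
      by (cases q) (simp add: truth_value_def)
  qed
  moreover have "inhabited (rule_type 6 [query] (Id Univ (emb_atom Var 6 query) (Var 8))) (sig_env runs)"
  proof (rule inhabited_rule_type)
    show "\<forall>p\<in>set [query]. avars p \<subseteq> {..<6}" using query_vars by simp
    fix \<rho> \<sigma> assume \<rho>: "sig_env_at runs \<rho> 6" "\<forall>i<6. \<rho> i = {Atom (\<sigma> i)}"
      and ps: "\<forall>p\<in>set [query]. runs (asubst \<sigma> p)"
    have "tmI (emb_atom Var 6 query) \<rho> = {Atom (truth_value (runs (asubst \<sigma> query)))}"
      using \<rho>(2) query_vars by (intro tmI_emb_atom[OF \<rho>(1)]) auto
    \<comment> \<open>A true premise denotes \<open>{Atom Leaf}\<close>, just as the constant does,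
      so both endpoints have the same class.\<close>
    with ps \<rho>(1) show "inhabited (Id Univ (emb_atom Var 6 query) (Var 8)) \<rho>"
      by (simp add: truth_value_def sig_env_at_def)
  qed
  ultimately show ?thesis by (auto simp: rules_def)
qed

text \<open>From right to left, provability of atoms is closed under the clauses, and the reflection
  axiom turns the proof into an equation. From left to right, the equation holds in the model that
  interprets the relation symbol by \<open>runs\<close>.\<close>

theorem adequacy:
  "horn_ctx rules \<turnstile> EqTerm (ground_atom rules (prog f, nums xs, num y)) leaf_var Univ \<longleftrightarrow>
   computes f xs y" (is "?E \<longleftrightarrow> ?C")
proof
  assume ?C
  let ?R = "\<lambda>a. \<exists>e. horn_ctx rules \<turnstile> HasType e (ground_atom rules a)"
  have "?R (prog f, nums xs, num y)"
  proof (rule computes_imp_closed[of ?R])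
    show "?R (asubst \<sigma> q)" if "(ps, q) \<in> set clauses" "\<forall>p\<in>set ps. ?R (asubst \<sigma> p)" for ps q \<sigma>
      using that by (rule rules_closed)
  qed (rule \<open>?C\<close>)
  then have "\<forall>p\<in>set [query]. ?R (asubst ((!) [prog f, nums xs, num y]) p)"
    by (simp add: query_def)
  from rule_type_elim[OF sig_rules _ _ this, of 6 "Id Univ (emb_atom Var 6 query) (Var 8)"] query_vars
  obtain e where "horn_ctx rules \<turnstile> HasType e
      (insts (lift (length rules) 6 (Id Univ (emb_atom Var 6 query) (Var 8)))
        (valuation 6 rules ((!) [prog f, nums xs, num y])))"
    by (auto simp: rules_def)
  \<comment> \<open>Lifted past the axioms, the constant has index \<open>8 + length rules\<close>;
    instantiating the six variables lowers it to \<open>leaf_var\<close>.\<close>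
  moreover have "insts (Var (8 + length rules)) (valuation 6 rules \<sigma>) = leaf_var" for \<sigma>
    using insts_Var_ge[of "valuation 6 rules \<sigma>" "length rules + 2"] by (simp add: add.commute)
  ultimately have "horn_ctx rules \<turnstile> HasType e
      (Id Univ (ground_atom rules (asubst ((!) [prog f, nums xs, num y]) query)) leaf_var)"
    by (simp add: insts_emb_atom[OF query_vars])
  then show ?E by (intro id_reflection[of _ e]) (simp add: query_def)
next
  assume ?E
  define \<rho> where "\<rho> = horn_env runs (length rules)"
  have \<rho>: "sig_env_at runs \<rho> (length rules)"
    by (simp add: \<rho>_def horn_env_def sig_env_at_def sig_env_def)
  have "tm_model.ctxI (horn_ctx rules) \<rho> \<rho>"
    unfolding \<rho>_def using sig_rules inhabited_rules by (intro ctxI_horn_ctx) auto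
  with tm_model.eqtmD(4)[of "horn_ctx rules"] tm_model.soundness[OF \<open>?E\<close>]
  have "tm_model.per SUniv (tmI (ground_atom rules (prog f, nums xs, num y)) \<rho>) (tmI leaf_var \<rho>)"
    by fastforce
  \<comment> \<open>The assignment is constantly \<open>Leaf\<close> because \<open>ground\<close>
    sends variables to the constant symbol; the codes involved are closed, so it leaves them
    unchanged.\<close>
  moreover have "tmI (ground_atom rules (prog f, nums xs, num y)) \<rho> =
      {Atom (truth_value (runs (asubst (\<lambda>_. Leaf) (prog f, nums xs, num y))))}"
    unfolding ground_atom_def using \<rho> by (intro tmI_emb_atom[OF \<rho>]) (simp add: sig_env_at_def)
  moreover have closed: "tsubst \<sigma> (num n) = num n" "tsubst \<sigma> (nums ns) = nums ns" for \<sigma> n ns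
  proof -
    show n: "tsubst \<sigma> (num n) = num n" for n by (induction n) simp_all
    show "tsubst \<sigma> (nums ns) = nums ns" by (induction ns) (simp_all add: n)
  qed
  moreover have "tsubst \<sigma> (prog f) = prog f" for \<sigma>
  proof (induction f)
    case (Compose f gs)
    then have "tsubst \<sigma> (prog_list (map prog gs)) = prog_list (map prog gs)"
      by (induction gs) simp_all
    with Compose show ?case by simp
  qed (simp_all add: closed)
  ultimately have "runs (prog f, nums xs, num y)"
    using \<rho> by (simp add: sig_env_at_def)
  from runsD(1)[OF this] show ?C by auto
qed

subsection \<open>The diagonal argument\<close>

text \<open>Determinism is what the diagonal argument contradicts. For \<open>Minimize\<close>, at
  the smaller of two results the function would have both the value 0 and a positive one.\<close>

lemma computes_unique: "computes f xs y \<Longrightarrow> computes f xs z \<Longrightarrow> y = z"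
proof (induction arbitrary: z rule: computes.induct)
  case (Compose xs gs ys f y)
  from Compose.prems obtain zs where zs: "list_all2 (\<lambda>g y. computes g xs y) gs zs" "computes f zs z"
    by (auto elim: computes.cases)
  have "ys = zs"
    using Compose.IH(1) zs(1) by (induction arbitrary: zs rule: list_all2_induct) (auto simp: list_all2_Cons1)
  with Compose zs show ?case by blast
next
  case (PrimRec_0 f xs y g)
  from PrimRec_0.prems show ?case by cases (auto intro: PrimRec_0.IH)
next
  case (PrimRec_Suc f g n xs y w)
  from PrimRec_Suc.prems show ?case by cases (use PrimRec_Suc.IH in blast)
next
  case (Minimize f n xs)
  from Minimize.prems have z: "computes f (z # xs) 0" "\<forall>m<z. \<exists>y. computes f (m # xs) (Suc y)"
    by (auto elim: computes.cases)
  show ?case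
  proof (rule linorder_cases)
    assume "n < z"
    with z(2) Minimize.IH(1) show ?thesis by (metis nat.distinct(1))
  next
    assume "z < n"
    with z(1) Minimize.IH(2) show ?thesis by (metis nat.distinct(1))
  qed
qed (auto elim: computes.cases)

section \<open>Programs that compute codes of expressions\<close>

primrec const_fun :: "nat \<Rightarrow> recfun" where
  "const_fun 0 = Zero"
| "const_fun (Suc c) = Compose Succ [const_fun c]"

definition add_fun :: recfun where
  "add_fun = PrimRec (Proj 0) (Compose Succ [Proj 1])"

definition triangle_fun :: recfun where
  "triangle_fun = PrimRec Zero (Compose Succ [Compose add_fun [Proj 1, Proj 0]])"

text \<open>Cantor pairing: \<open>prod_encode (m, n)\<close> is
  \<open>triangle (m + n) + m\<close>.\<close>

definition pair_fun :: "recfun \<Rightarrow> recfun \<Rightarrow> recfun" where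
  "pair_fun f g = Compose add_fun [Compose triangle_fun [Compose add_fun [f, g]], f]"

text \<open>The constant 4 is the tag of \<open>App\<close> in \<open>expr_code\<close>.\<close>

definition app_fun :: "recfun \<Rightarrow> recfun \<Rightarrow> recfun" where
  "app_fun f g = pair_fun (const_fun 4) (pair_fun f g)"

lemma computes_Compose1: "computes g xs y \<Longrightarrow> computes f [y] z \<Longrightarrow> computes (Compose f [g]) xs z"
  by (rule computes.Compose[of xs _ "[y]"]) simp_all

lemma computes_Compose2:
  "computes g xs y \<Longrightarrow> computes h xs z \<Longrightarrow> computes f [y, z] w \<Longrightarrow> computes (Compose f [g, h]) xs w"
  by (rule computes.Compose[of xs _ "[y, z]"]) simp_all

lemma computes_Proj: "i < length xs \<Longrightarrow> xs ! i = y \<Longrightarrow> computes (Proj i) xs y"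
  using computes.Proj by blast

lemma computes_const_fun: "computes (const_fun c) xs c"
  by (induction c) (auto intro: computes.intros computes_Compose1)

lemma computes_add_fun: "computes add_fun [m, n] (m + n)"
proof (induction m)
  case 0
  then show ?case unfolding add_fun_def by (auto intro!: computes.PrimRec_0 computes_Proj)
next
  case (Suc m)
  have "computes (Compose Succ [Proj 1]) [m, m + n, n] (Suc (m + n))"
    by (rule computes_Compose1[of _ _ "m + n"]) (auto intro: computes_Proj computes.Succ)
  with Suc show ?case unfolding add_fun_def by (auto intro: computes.PrimRec_Suc)
qed

lemma computes_triangle_fun: "computes triangle_fun [n] (triangle n)"
proof (induction n)
  case 0
  then show ?case unfolding triangle_fun_def by (auto intro!: computes.intros)
next
  case (Suc n)
  have "computes (Compose Succ [Compose add_fun [Proj 1, Proj 0]]) [n, triangle n] (Suc (triangle n + n))"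
    by (intro computes_Compose1[OF _ computes.Succ] computes_Compose2[OF _ _ computes_add_fun])
      (simp_all add: computes_Proj)
  with Suc show ?case unfolding triangle_fun_def by (auto intro: computes.PrimRec_Suc)
qed

lemma computes_pair_fun:
  "computes f xs m \<Longrightarrow> computes g xs n \<Longrightarrow> computes (pair_fun f g) xs (prod_encode (m, n))"
  unfolding pair_fun_def prod_encode_def prod.case
  by (intro computes_Compose2[OF _ _ computes_add_fun] computes_Compose1[OF _ computes_triangle_fun])

lemma computes_app_fun:
  "computes f xs (expr_code c) \<Longrightarrow> computes g xs (expr_code a) \<Longrightarrow>
   computes (app_fun f g) xs (expr_code (App c a))"
  unfolding app_fun_def expr_code.simps by (intro computes_pair_fun computes_const_fun)

abbreviation code_fun :: "expr \<Rightarrow> recfun" where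
  "code_fun e \<equiv> const_fun (expr_code e)"

text \<open>Since \<open>num (Suc n)\<close> is \<open>Node Leaf (num n)\<close>, each recursion
  step prefixes the fixed partial application that stands for \<open>Node Leaf\<close>.\<close>

definition num_fun :: recfun where
  "num_fun = PrimRec (code_fun leaf_var)
     (app_fun (code_fun (App (Var (length rules + 1)) leaf_var)) (Proj 1))"

lemma computes_num_fun: "computes num_fun [n] (expr_code (ground rules (num n)))"
proof (induction n)
  case 0
  then show ?case
    unfolding num_fun_def ground_def by (auto intro!: computes.PrimRec_0 computes_const_fun)
next
  case (Suc n)
  let ?e = "ground rules (num n)"
  have "computes (app_fun (code_fun (App (Var (length rules + 1)) leaf_var)) (Proj 1))
      [n, expr_code ?e] (expr_code (App (App (Var (length rules + 1)) leaf_var) ?e))"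
    by (intro computes_app_fun computes_const_fun) (simp add: computes_Proj)
  moreover have "App (App (Var (length rules + 1)) leaf_var) ?e = ground rules (num (Suc n))"
    by (simp add: ground_def)
  ultimately show ?case
    using Suc unfolding num_fun_def by (metis computes.PrimRec_Suc)
qed

text \<open>The number of a program is the code of the expression that represents it, so the code of the
  self-application is computed from the number without any decoding.\<close>

definition self_fun :: recfun where
  "self_fun = app_fun (app_fun (app_fun (code_fun (Var (length rules))) (Proj 0))
     (app_fun (app_fun (code_fun (Var (length rules + 1))) num_fun) (code_fun leaf_var)))
     (code_fun leaf_var)"

lemma computes_self_fun:
  assumes "n = expr_code (ground rules (prog f))"
  shows "computes self_fun [n] (expr_code (ground_atom rules (prog f, nums [n], num 0)))"
proof -
  have "ground_atom rules (prog f, nums [n], num 0) =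
      App (App (App (Var (length rules)) (ground rules (prog f)))
        (App (App (Var (length rules + 1)) (ground rules (num n))) leaf_var)) leaf_var"
    by (simp add: ground_atom_def ground_def)
  then show ?thesis
    unfolding self_fun_def using assms
    by (auto intro!: computes_app_fun computes_const_fun computes_num_fun computes_Proj
        simp del: expr_code.simps)
qed

theorem theorem2p4:
  shows "\<not> (\<exists>f. \<forall>\<Gamma> A M M'.
    \<Gamma> \<turnstile> HasType M A \<longrightarrow> \<Gamma> \<turnstile> HasType M' A \<longrightarrow>
      computes f [ctx_code \<Gamma>, expr_code A, expr_code M, expr_code M']
        (if \<Gamma> \<turnstile> EqTerm M M' A then 1 else 0))"
proof
  assume "\<exists>f. \<forall>\<Gamma> A M M'.
    \<Gamma> \<turnstile> HasType M A \<longrightarrow> \<Gamma> \<turnstile> HasType M' A \<longrightarrow>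
      computes f [ctx_code \<Gamma>, expr_code A, expr_code M, expr_code M']
        (if \<Gamma> \<turnstile> EqTerm M M' A then 1 else 0)"
  then obtain f where f: "computes f [ctx_code \<Gamma>, expr_code A, expr_code M, expr_code M']
      (if \<Gamma> \<turnstile> EqTerm M M' A then 1 else 0)"
    if "\<Gamma> \<turnstile> HasType M A" "\<Gamma> \<turnstile> HasType M' A" for \<Gamma> A M M'
    by blast
  \<comment> \<open>The diagonal program: on the number \<open>n\<close> of a program it asks
    \<open>f\<close> whether the atom stating that this program returns 0 on \<open>n\<close> equals
    the constant symbol.\<close>
  define d where "d = Compose f
    [const_fun (ctx_code (horn_ctx rules)), code_fun Univ, self_fun, code_fun leaf_var]"
  \<comment> \<open>The program \<open>d\<close> is run on its own number.\<close>
  define n where "n = expr_code (ground rules (prog d))"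
  define M where "M = ground_atom rules (prog d, nums [n], num 0)"
  have "computes f [ctx_code (horn_ctx rules), expr_code Univ, expr_code M, expr_code leaf_var]
      (if horn_ctx rules \<turnstile> EqTerm M leaf_var Univ then 1 else 0)"
    unfolding M_def
    using deriv_ground_atom[OF sig_rules] deriv_ground_atom(2)[OF sig_rules, of Leaf]
    by (intro f) (simp_all add: ground_def)
  moreover have "list_all2 (\<lambda>g y. computes g [n] y)
      [const_fun (ctx_code (horn_ctx rules)), code_fun Univ, self_fun, code_fun leaf_var]
      [ctx_code (horn_ctx rules), expr_code Univ, expr_code M, expr_code leaf_var]"
    unfolding M_def list.rel_inject using computes_self_fun[OF n_def]
    by (simp add: computes_const_fun del: expr_code.simps)
  ultimately have "computes d [n] (if horn_ctx rules \<turnstile> EqTerm M leaf_var Univ then 1 else 0)"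
    unfolding d_def by (intro computes.Compose)
  \<comment> \<open>By adequacy the queried equation is derivable iff \<open>d\<close> returns 0 on
    \<open>n\<close>.\<close>
  then have "computes d [n] (if computes d [n] 0 then 1 else 0)"
    unfolding M_def adequacy .
  \<comment> \<open>If 0 is a value of \<open>d\<close> at \<open>n\<close>, then so is 1, against
    determinism; if it is not, the value is 0 after all.\<close>
  then show False
    using computes_unique[of d "[n]" 0 1] by (auto split: if_splits)
qed

end
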